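(* Let $G$ be a connected graph. (i) If $\alpha(G)\le 2$, then $G$ has an antimagic orientation. (ii) If $\alpha(G)=3$ and $|V(G)|\ge 13$, then $G$ has an antimagic orientation. (iii) If $\alpha(G)=4$ and $\delta(G)\ge 11$, then $G$ has an antimagic orientation.
   Context: All graphs are finite and simple. $\alpha(G)$ denotes the independence number of $G$ (maximum size of a set of pairwise non-adjacent vertices) and $\delta(G)$ its minimum degree. For a digraph $D$ with $m$ arcs, arc set $A(D)$, and a bijection $\tau:A(D)\to\{1,2,\ldots,m\}$, the vertex-sum $s_{(D,\tau)}(u)$ of a vertex $u$ is the sum of the labels of all arcs entering $u$ minus the sum of the labels of all arcs leaving $u$ (and $s_{(D,\tau)}(u):=0$ if $u$ is isolated). The bijection $\tau$ is an antimagic labeling of $D$ if $s_{(D,\tau)}(u)\ne s_{(D,\tau)}(v)$ for all distinct vertices $u,v$ of $D$. An antimagic orientation of a graph $G$ is a pair $(D,\tau)$ where $D$ is an orientation of $G$ (each edge of $G$ is replaced by exactly one of its two possible arcs) and $\tau$ is an antimagic labeling of $D$. *)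

theory Defs
  imports "Graph_Theory.Graph_Theory"
begin

(* Following the AFP entry Graph_Theory, a finite simple graph is a finite loop-free symmetric
   digraph (locale pair_graph): the undirected edge uv is the pair of opposite arcs (u,v), (v,u).
   Proper digraphs are elements of the same record type 'a pair_pre_digraph. *)

definition independent_set :: "'a pair_pre_digraph \<Rightarrow> 'a set \<Rightarrow> bool" where
  "independent_set G S \<longleftrightarrow> S \<subseteq> pverts G \<and> pairwise (\<lambda>u v. (u, v) \<notin> parcs G) S"

definition independence_number :: "'a pair_pre_digraph \<Rightarrow> nat" where
  "independence_number G = Max {card S | S. independent_set G S}"

(* In a symmetric loop-free digraph the out-neighbours of v are exactly the neighbours of v in the
   undirected graph, so out_degree is the undirected degree. *)
definition min_degree :: "'a pair_pre_digraph \<Rightarrow> nat" where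
  "min_degree G = Min ((\<lambda>v. out_degree (with_proj G) v) ` pverts G)"

definition orientation_of :: "'a pair_pre_digraph \<Rightarrow> 'a pair_pre_digraph \<Rightarrow> bool" where
  "orientation_of D G \<longleftrightarrow> pverts D = pverts G \<and> parcs D \<subseteq> parcs G \<and>
     (\<forall>u v. (u, v) \<in> parcs G \<longrightarrow> ((u, v) \<in> parcs D \<longleftrightarrow> (v, u) \<notin> parcs D))"

definition vertex_sum :: "'a pair_pre_digraph \<Rightarrow> ('a \<times> 'a \<Rightarrow> nat) \<Rightarrow> 'a \<Rightarrow> int" where
  "vertex_sum D \<tau> u =
     (\<Sum>e\<in>in_arcs (with_proj D) u. int (\<tau> e)) - (\<Sum>e\<in>out_arcs (with_proj D) u. int (\<tau> e))"

(* The separate convention for isolated vertices is the empty-sum case. *)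
lemma vertex_sum_isolated:
  assumes "in_arcs (with_proj D) u = {}" "out_arcs (with_proj D) u = {}"
  shows "vertex_sum D \<tau> u = 0"
  using assms by (simp add: vertex_sum_def)

definition antimagic_labeling :: "'a pair_pre_digraph \<Rightarrow> ('a \<times> 'a \<Rightarrow> nat) \<Rightarrow> bool" where
  "antimagic_labeling D \<tau> \<longleftrightarrow> bij_betw \<tau> (parcs D) {1..card (parcs D)} \<and>
     (\<forall>u\<in>pverts D. \<forall>v\<in>pverts D. u \<noteq> v \<longrightarrow> vertex_sum D \<tau> u \<noteq> vertex_sum D \<tau> v)"

definition antimagic_orientation ::
    "'a pair_pre_digraph \<Rightarrow> 'a pair_pre_digraph \<Rightarrow> ('a \<times> 'a \<Rightarrow> nat) \<Rightarrow> bool" where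
  "antimagic_orientation G D \<tau> \<longleftrightarrow> orientation_of D G \<and> antimagic_labeling D \<tau>"

end

theory Submission
  imports Defs "HOL-Library.Multiset"
begin

text \<open>
Let S be a maximum independent set. It has at most four elements, the centres, and every other
vertex, a leaf, has a neighbour in S. Every leaf u chooses one centre f u; the arcs from f u to u are
the star arcs. All edges between centres and leaves are oriented towards the leaf, the edges among the
leaves get the lowest labels, and the star arcs are labelled last: if the leaves are sorted by what
they have received from all other arcs and the star arcs get increasing labels in this order, then
the sums of the leaves are strictly increasing (\<open>antimagic_arrangement\<close>). Centres have only
outgoing arcs, so their sums lie below those of the leaves as soon as the edges among the leaves do
not pull any sum down too far. \<open>low_labelling\<close> guarantees this: the edges of a graph can
be oriented and labelled by 1, ..., m with all sums at least -m. So only the few centres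
have to be kept apart from each other.

One centre is no problem. For two centres, the two sums add up to minus the total of the labels between
centres and leaves. If that total is odd, the sums differ; if it is even, exchanging the highest label
of the edges among the leaves with the next one makes it odd. Small degrees are treated by comparing
sizes.

For three and four centres some edge-disjoint directed cycles among the leaves are put aside. The
labels of a cycle are consecutive, and increasing all of them by the same amount changes the sum of no
vertex. A cycle of length q can therefore be moved upwards past the lowest j star arcs: the order of
the leaves stays valid, and the sum of a centre x increases by q times the number of star arcs of x
among these j (\<open>antimagic_by_cycles\<close>). Whatever the order of the star arcs is,
k (k - 1) / 2 cycles suffice to make the sums of k centres distinct
(\<open>separating_many\<close>), and two cycles suffice for three centres
(\<open>separating_two\<close>).

The hypotheses of the theorem provide the cycles. With independence number four and minimum degree
eleven, every leaf has at least seven neighbours among the leaves, and a graph of minimum degree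
2 r + 1 contains 1 + \<dots> + r edge-disjoint cycles, found in fans at the end of a longest path
(\<open>edge_disjoint_cycles\<close>); for r = 3 these are the required six. With independence number
three and thirteen vertices there are at least ten leaves, which contain a triangle and, among the
remaining seven, another cycle (\<open>two_disjoint_cycles\<close>).
\<close>

section \<open>Signed sums of arc lists\<close>

definition incidence :: "'a \<times> 'a \<Rightarrow> 'a \<Rightarrow> int" where
  "incidence e v = of_bool (snd e = v) - of_bool (fst e = v)"

text \<open>A labelling is given by the order of the arcs in a list: the arcs get the labels b + 1, b + 2, and so
on, and the sum at v is taken with these labels. Rearranging a list always yields another bijective
labelling, and the offset b makes the sums of a concatenation additive.\<close>

primrec lsum :: "nat \<Rightarrow> ('a \<times> 'a) list \<Rightarrow> 'a \<Rightarrow> int" where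
  "lsum b [] v = 0"
| "lsum b (e # es) v = int (Suc b) * incidence e v + lsum (Suc b) es v"

lemma lsum_append: "lsum b (xs @ ys) v = lsum b xs v + lsum (b + length xs) ys v"
  by (induction xs arbitrary: b) auto

lemma lsum_conv_sum: "lsum b es v = (\<Sum>i<length es. int (b + i + 1) * incidence (es ! i) v)"
proof (induction es arbitrary: b)
  case (Cons e es)
  show ?case
    by (simp add: Cons.IH sum.lessThan_Suc_shift del: sum.lessThan_Suc)
qed simp

lemma lsum_eq_0: "(\<And>e. e \<in> set es \<Longrightarrow> fst e \<noteq> v \<and> snd e \<noteq> v) \<Longrightarrow> lsum b es v = 0"
  by (induction es arbitrary: b) (auto simp: incidence_def)

lemma lsum_nonneg_if_no_out: "(\<And>e. e \<in> set es \<Longrightarrow> fst e \<noteq> v) \<Longrightarrow> lsum b es v \<ge> 0"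
  by (induction es arbitrary: b) (auto simp: incidence_def)

lemma lsum_le_if_no_in:
  "(\<And>e. e \<in> set es \<Longrightarrow> snd e \<noteq> v) \<Longrightarrow> lsum b es v \<le> - int (length (filter (\<lambda>e. fst e = v) es))"
proof (induction es arbitrary: b)
  case (Cons e es)
  have "lsum (Suc b) es v \<le> - int (length (filter (\<lambda>e. fst e = v) es))"
    using Cons by auto
  then show ?case using Cons.prems by (auto simp: incidence_def)
qed simp

text \<open>Summed over S, an arc inside S would cancel; here only the arcs that leave S count.\<close>

lemma sum_lsum:
  assumes "finite S" "\<And>e. e \<in> set es \<Longrightarrow> snd e \<notin> S"
  shows "(\<Sum>x\<in>S. lsum b es x) = - (\<Sum>i<length es. if fst (es ! i) \<in> S then int (b + i + 1) else 0)"
proof -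
  have inc: "(\<Sum>x\<in>S. incidence e x) = (if fst e \<in> S then - 1 else 0)" if "snd e \<notin> S" for e
  proof -
    have "(\<Sum>x\<in>S. incidence e x) = (\<Sum>x\<in>S. if fst e = x then - 1 else 0)"
      using that by (intro sum.cong) (auto simp: incidence_def)
    then show ?thesis using assms(1) by (simp add: sum.delta)
  qed
  have "(\<Sum>x\<in>S. lsum b es x) = (\<Sum>i<length es. \<Sum>x\<in>S. int (b + i + 1) * incidence (es ! i) x)"
    unfolding lsum_conv_sum by (rule sum.swap)
  also have "\<dots> = (\<Sum>i<length es. - (if fst (es ! i) \<in> S then int (b + i + 1) else 0))"
    using assms(2) by (intro sum.cong refl) (simp add: inc flip: sum_distrib_left)
  finally show ?thesis by (simp only: sum_negf)
qed

section \<open>Orientations and their labellings\<close>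

definition orients :: "('a \<times> 'a) set \<Rightarrow> ('a \<times> 'a) set \<Rightarrow> bool" where
  "orients A R \<longleftrightarrow> A \<inter> A\<inverse> = {} \<and> A \<union> A\<inverse> = R"

lemma orients_Un:
  assumes "orients A R" "orients A' R'" "R \<inter> R' = {}"
  shows "orients (A \<union> A') (R \<union> R')"
proof -
  have *: "A' \<subseteq> R'" "A'\<inverse> \<subseteq> R'" "A \<subseteq> R" "A\<inverse> \<subseteq> R"
    using assms unfolding orients_def by auto
  have "(A \<union> A') \<inter> (A \<union> A')\<inverse> = (A \<inter> A\<inverse>) \<union> (A' \<inter> A'\<inverse>)"
    using * assms(3) by auto
  then show ?thesis
    using assms unfolding orients_def by auto
qed

lemma vertex_sum_eq_lsum:
  assumes "distinct ws" "\<And>i. i < length ws \<Longrightarrow> \<tau> (ws ! i) = Suc i"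
  shows "vertex_sum \<lparr>pverts = V, parcs = set ws\<rparr> \<tau> v = lsum 0 ws v"
proof -
  let ?D = "\<lparr>pverts = V, parcs = set ws\<rparr>"
  have "vertex_sum ?D \<tau> v = (\<Sum>e\<in>set ws. if snd e = v then int (\<tau> e) else 0) - (\<Sum>e\<in>set ws. if fst e = v then int (\<tau> e) else 0)"
    by (simp add: vertex_sum_def in_arcs_def out_arcs_def sum.If_cases Int_def)
  also have "\<dots> = (\<Sum>e\<in>set ws. int (\<tau> e) * incidence e v)"
    by (auto simp: incidence_def simp flip: sum_subtractf intro!: sum.cong)
  also have "\<dots> = (\<Sum>i<length ws. int (\<tau> (ws ! i)) * incidence (ws ! i) v)"
    using assms(1) by (intro sum.reindex_bij_betw[symmetric] bij_betw_nth) auto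
  finally show ?thesis
    by (simp add: lsum_conv_sum assms(2))
qed

lemma antimagic_of_list:
  assumes "distinct ws" "orients (set ws) (parcs G)" "inj_on (lsum 0 ws) (pverts G)"
  shows "\<exists>D \<tau>. antimagic_orientation G D \<tau>"
proof -
  define D where "D = \<lparr>pverts = pverts G, parcs = set ws\<rparr>"
  define \<tau> where "\<tau> e = Suc (the_inv_into {..<length ws} (nth ws) e)" for e
  have inj: "inj_on (nth ws) {..<length ws}"
    using assms(1) by (simp add: inj_on_nth)
  have tau: "\<tau> (ws ! i) = Suc i" if "i < length ws" for i
    using that inj by (simp add: \<tau>_def the_inv_into_f_f)
  have "bij_betw (nth ws) {..<length ws} (set ws)"
    using assms(1) by (intro bij_betw_nth) auto
  then have "bij_betw (the_inv_into {..<length ws} (nth ws)) (set ws) {..<length ws}"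
    by (rule bij_betw_the_inv_into)
  moreover have "bij_betw Suc {..<length ws} {1..length ws}"
    by (rule bij_betwI[where g = "\<lambda>n. n - 1"]) auto
  ultimately have "bij_betw (Suc \<circ> the_inv_into {..<length ws} (nth ws)) (set ws) {1..length ws}"
    by (rule bij_betw_trans)
  then have "bij_betw \<tau> (set ws) {1..length ws}"
    unfolding \<tau>_def by (simp only: comp_def)
  moreover have "card (set ws) = length ws"
    using assms(1) by (rule distinct_card)
  moreover have "vertex_sum D \<tau> = lsum 0 ws"
    using vertex_sum_eq_lsum[OF assms(1) tau] by (auto simp: D_def)
  ultimately have "antimagic_labeling D \<tau>"
    using assms(3) by (auto simp: antimagic_labeling_def D_def inj_on_def)
  moreover have "orientation_of D G"
    using assms(2) by (auto simp: orientation_of_def D_def orients_def)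
  ultimately show ?thesis
    by (auto simp: antimagic_orientation_def)
qed

section \<open>Directed cycles with consecutive labels\<close>

fun walk_arcs :: "'a list \<Rightarrow> ('a \<times> 'a) list" where
  "walk_arcs (x # y # zs) = (x, y) # walk_arcs (y # zs)"
| "walk_arcs _ = []"

text \<open>Labels increase by one along a walk, so each passage through a vertex contributes the difference of two
consecutive labels, which is -1. Only the two ends of the walk see the size of the labels.\<close>

lemma lsum_walk_arcs:
  "lsum b (walk_arcs (x # p @ [y])) v =
     (int b + int (length p) + 1) * of_bool (y = v) - (int b + 1) * of_bool (x = v) - int (count_list p v)"
proof (induction p arbitrary: x b)
  case (Cons a p)
  show ?case by (simp add: Cons.IH incidence_def algebra_simps)
qed (auto simp: incidence_def algebra_simps)

lemma map_fst_walk_arcs: "map fst (walk_arcs (p @ [y])) = p"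
  by (induction p rule: walk_arcs.induct) auto

lemma map_snd_walk_arcs: "map snd (walk_arcs (x # p)) = p"
  by (induction p arbitrary: x) auto

lemma walk_arcs_append:
  "walk_arcs (xs @ y # zs) = walk_arcs (xs @ [y]) @ walk_arcs (y # zs)"
  by (induction xs rule: walk_arcs.induct) auto

text \<open>Three or more arcs are required, because a closed walk of two arcs would use both orientations of
one edge.\<close>

definition dicycle :: "('a \<times> 'a) set \<Rightarrow> ('a \<times> 'a) list \<Rightarrow> bool" where
  "dicycle R C \<longleftrightarrow>
     (\<exists>x p. distinct (x # p) \<and> length p \<ge> 2 \<and> C = walk_arcs (x # p @ [x]) \<and> set C \<subseteq> R)"

lemma dicycle_mono: "dicycle R C \<Longrightarrow> R \<subseteq> R' \<Longrightarrow> dicycle R' C"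
  unfolding dicycle_def by (elim exE) (rule exI, rule exI, auto)

text \<open>At each vertex as many arcs of a cycle enter as leave. This is why a cycle with consecutive labels can
be moved through the labelling without any effect on its vertices.\<close>

lemma dicycle_lsum_shift: "dicycle R C \<Longrightarrow> lsum b C v = lsum b' C v"
  by (auto simp: dicycle_def lsum_walk_arcs[of _ x _ x for x] algebra_simps)

lemma distinct_count_list_le_1: "distinct p \<Longrightarrow> count_list p v \<le> 1"
  by (induction p) (auto simp: count_list_0_iff)

lemma map_fst_closed_walk: "map fst (walk_arcs (x # p @ [x])) = x # p"
  using map_fst_walk_arcs[of "x # p" x] by simp

lemma map_snd_closed_walk: "map snd (walk_arcs (x # p @ [x])) = p @ [x]"
  by (rule map_snd_walk_arcs)

lemma dicycle_lsum_ge: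
  assumes "dicycle R C"
  shows "lsum b C v \<ge> - 1"
proof -
  obtain x p where xp: "distinct (x # p)" and C: "C = walk_arcs (x # p @ [x])"
    using assms by (auto simp: dicycle_def)
  have "count_list p v \<le> (if v = x then 0 else 1)"
    using xp distinct_count_list_le_1[of p v] by (auto simp: count_list_0_iff)
  then show ?thesis
    unfolding C lsum_walk_arcs by (auto split: if_splits)
qed

lemma dicycle_nonempty: "dicycle R C \<Longrightarrow> C \<noteq> []"
  unfolding dicycle_def by (metis list.distinct(1) list.map_disc_iff map_fst_closed_walk)

lemma dicycle_subset: "dicycle R C \<Longrightarrow> set C \<subseteq> R"
  by (auto simp: dicycle_def)

lemma dicycle_distinct: "dicycle R C \<Longrightarrow> distinct (map fst C) \<and> distinct (map snd C)"
  unfolding dicycle_def by (auto simp: map_fst_closed_walk map_snd_closed_walk)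

text \<open>If the i-th arc is the reverse of the j-th one, then each of i and j is the cyclic successor of the
other, which is only possible in a cycle of length at most two.\<close>

lemma dicycle_asym:
  assumes "dicycle R C"
  shows "set C \<inter> (set C)\<inverse> = {}"
proof -
  obtain x p where xp: "distinct (x # p)" "length p \<ge> 2" and C: "C = walk_arcs (x # p @ [x])"
    using assms by (auto simp: dicycle_def)
  define n where "n = Suc (length p)"
  have len: "length C = n"
    using map_fst_closed_walk[of x p] unfolding C n_def by (metis length_Cons length_map)
  have fstC: "fst (C ! i) = (x # p) ! i" if "i < n" for i
    using map_fst_closed_walk[of x p] that len unfolding C by (metis nth_map)
  have sndC: "snd (C ! i) = (x # p) ! (Suc i mod n)" if "i < n" for i
  proof -
    have "snd (C ! i) = (p @ [x]) ! i"
      using map_snd_closed_walk[of x p] that len unfolding C by (metis nth_map)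
    also have "\<dots> = (x # p) ! (Suc i mod n)"
      using that by (cases "Suc i = n") (auto simp: nth_append n_def)
    finally show ?thesis .
  qed
  have eq: "i = j" if "(x # p) ! i = (x # p) ! j" "i < n" "j < n" for i j
    using that xp(1) by (metis n_def length_Cons nth_eq_iff_index_eq)
  have False if ab: "(a, b) \<in> set C" "(b, a) \<in> set C" for a b
  proof -
    obtain i where i: "i < n" "C ! i = (a, b)"
      using ab(1) unfolding in_set_conv_nth len by blast
    obtain j where j: "j < n" "C ! j = (b, a)"
      using ab(2) unfolding in_set_conv_nth len by blast
    note ij = i j
    have n3: "n \<ge> 3" using xp(2) by (simp add: n_def)
    have m: "Suc k mod n < n" for k using n3 by simp
    have "j = Suc i mod n"
      using fstC[OF ij(3)] sndC[OF ij(1)] unfolding ij by (intro eq m ij) simp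
    then have j: "j = (if Suc i = n then 0 else Suc i)"
      using ij(1) by simp
    have "i = Suc j mod n"
      using fstC[OF ij(1)] sndC[OF ij(3)] unfolding ij by (intro eq m ij) simp
    then have "i = (if Suc j = n then 0 else Suc j)"
      using ij(3) by simp
    then have "(Suc j = n \<and> i = 0) \<or> i = Suc j" by metis
    moreover have "(Suc i = n \<and> j = 0) \<or> j = Suc i" using j by metis
    ultimately show False
      using n3 by (elim disjE conjE; linarith)
  qed
  then show ?thesis by auto
qed

definition dicycles :: "('a \<times> 'a) set \<Rightarrow> ('a \<times> 'a) list list \<Rightarrow> bool" where
  "dicycles R Cs \<longleftrightarrow> (\<forall>C\<in>set Cs. dicycle R C) \<and> distinct (concat Cs) \<and>
     set (concat Cs) \<inter> (set (concat Cs))\<inverse> = {}"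

lemma dicycles_Nil: "dicycles R []"
  by (simp add: dicycles_def)

lemma dicycles_mono: "dicycles R Cs \<Longrightarrow> R \<subseteq> R' \<Longrightarrow> dicycles R' Cs"
  by (auto simp: dicycles_def intro: dicycle_mono)

lemma dicycles_subset: "dicycles R Cs \<Longrightarrow> set (concat Cs) \<subseteq> R"
  unfolding dicycles_def using dicycle_subset by fastforce

lemma dicycles_append:
  assumes "dicycles R Cs" "dicycles (R - (set (concat Cs) \<union> (set (concat Cs))\<inverse>)) Ds"
  shows "dicycles R (Cs @ Ds)"
proof -
  let ?E = "set (concat Cs)" and ?F = "set (concat Ds)"
  have F: "?F \<subseteq> R - (?E \<union> ?E\<inverse>)"
    using dicycles_subset[OF assms(2)] .
  have "\<forall>C\<in>set (Cs @ Ds). dicycle R C"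
    using assms dicycle_mono[of "R - (?E \<union> ?E\<inverse>)" _ R] unfolding dicycles_def by auto
  moreover have "distinct (concat (Cs @ Ds))"
  proof -
    have "distinct (concat Cs)" "distinct (concat Ds)"
      using assms by (auto simp: dicycles_def)
    moreover have "?E \<inter> ?F = {}" using F by blast
    ultimately show ?thesis by (simp only: concat_append distinct_append simp_thms)
  qed
  moreover have "(?E \<union> ?F) \<inter> (?E \<union> ?F)\<inverse> = {}"
  proof -
    have "?E \<inter> ?E\<inverse> = {}" "?F \<inter> ?F\<inverse> = {}"
      using assms unfolding dicycles_def by blast+
    moreover have "?E \<inter> ?F\<inverse> = {}" "?F \<inter> ?E\<inverse> = {}"
      using F by auto
    ultimately show ?thesis by (simp only: converse_Un) blast
  qed
  ultimately show ?thesis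
    by (simp only: dicycles_def concat_append set_append)
qed

lemma dicycles_Cons:
  assumes "dicycle R C" "dicycles (R - (set C \<union> (set C)\<inverse>)) Cs"
  shows "dicycles R (C # Cs)"
proof -
  have "distinct C" using dicycle_distinct[OF assms(1)] by (simp add: distinct_map)
  then have "dicycles R [C]"
    using assms(1) dicycle_asym[OF assms(1)] by (simp add: dicycles_def)
  then show ?thesis
    using dicycles_append[of R "[C]" Cs] assms(2) by simp
qed

section \<open>Cycles at the end of a longest path\<close>

text \<open>A neighbour of the first vertex outside the path could be put in front of it.\<close>

lemma longest_path:
  assumes "finite W" "w \<in> W" "R \<subseteq> W \<times> W" "sym R" "irrefl R"
  obtains v q where "distinct (v # q)" "set (v # q) \<subseteq> W" "set (walk_arcs (v # q)) \<subseteq> R"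
    "R `` {v} \<subseteq> set q"
proof -
  define P where "P l \<longleftrightarrow> l \<noteq> [] \<and> distinct l \<and> set l \<subseteq> W \<and> set (walk_arcs l) \<subseteq> R" for l
  have "P [w]" using assms(2) by (simp add: P_def)
  moreover have "length l \<le> card W" if "P l" for l
    using that assms(1) unfolding P_def by (metis card_mono distinct_card)
  then have "\<forall>l. P l \<longrightarrow> length l < Suc (card W)"
    by (simp add: less_Suc_eq_le)
  ultimately obtain l where l: "P l" "\<And>l'. P l' \<Longrightarrow> length l' \<le> length l"
    using ex_has_greatest_nat[of P "[w]" length "Suc (card W)"] by blast
  then obtain v q where vq: "l = v # q"
    by (cases l) (auto simp: P_def)
  have "y \<in> set q" if "(v, y) \<in> R" for y
  proof (rule ccontr)
    assume "y \<notin> set q"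
    moreover have "y \<noteq> v" using that assms(5) by (auto simp: irrefl_def)
    moreover have "(y, v) \<in> R" "y \<in> W" using that assms(3,4) by (auto dest: symD)
    ultimately have "P (y # l)"
      using l(1) by (auto simp: P_def vq)
    then show False using l(2) by fastforce
  qed
  then show ?thesis
    using that[of v q] l(1) by (auto simp: P_def vq)
qed

lemma walk_arcs_suffix_subset: "set (walk_arcs q) \<subseteq> set (walk_arcs (p @ q))"
proof (cases q)
  case (Cons a q')
  then show ?thesis using walk_arcs_append[of p a q'] by simp
qed simp

lemma walk_arcs_prefix_subset: "set (walk_arcs p) \<subseteq> set (walk_arcs (p @ q))"
  by (induction p rule: walk_arcs.induct) auto

text \<open>N stands for the neighbours of the first vertex v of a longest path, and q for the rest of the path.
Every segment is closed to a cycle through v. Cutting at consecutive elements of N keeps N away from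
the interior of the segments; \<open>fan_of_cycles\<close> needs this to bound the loss of degree.\<close>

lemma disjoint_segments:
  assumes "distinct q" "card (N \<inter> set q) \<ge> 2 * r"
  shows "\<exists>segs. length segs = r \<and> distinct (concat segs) \<and> set (concat segs) \<subseteq> set q \<and>
    (\<forall>s\<in>set segs. length s \<ge> 2 \<and> hd s \<in> N \<and> last s \<in> N \<and> set s \<inter> N \<subseteq> {hd s, last s} \<and>
       set (walk_arcs s) \<subseteq> set (walk_arcs q))"
  using assms
proof (induction r arbitrary: q)
  case 0
  show ?case by (rule exI[of _ "[]"]) simp
next
  case (Suc r)
  have "\<exists>x\<in>set q. x \<in> N"
  proof (rule ccontr)
    assume "\<not> (\<exists>x\<in>set q. x \<in> N)"
    then have "N \<inter> set q = {}" by auto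
    then show False using Suc.prems(2) by simp
  qed
  from split_list_first_prop[OF this]
  obtain q1 a q2 where q: "q = q1 @ a # q2" "a \<in> N" "\<forall>y\<in>set q1. y \<notin> N"
    by blast
  have N: "N \<inter> set q = insert a (N \<inter> set q2)"
    using q by auto
  have "a \<notin> set q2" using Suc.prems(1) q(1) by auto
  then have c2: "card (N \<inter> set q2) \<ge> Suc (2 * r)"
    using Suc.prems(2) unfolding N by (subst (asm) card_insert_disjoint) auto
  have "\<exists>x\<in>set q2. x \<in> N"
  proof (rule ccontr)
    assume "\<not> (\<exists>x\<in>set q2. x \<in> N)"
    then have "N \<inter> set q2 = {}" by auto
    then show False using c2 by simp
  qed
  from split_list_first_prop[OF this]
  obtain q3 b q4 where q2: "q2 = q3 @ b # q4" "b \<in> N" "\<forall>y\<in>set q3. y \<notin> N"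
    by blast
  have N2: "N \<inter> set q2 = insert b (N \<inter> set q4)"
    using q2 by auto
  have "b \<notin> set q4" using Suc.prems(1) q(1) q2(1) by auto
  then have c4: "card (N \<inter> set q4) \<ge> 2 * r"
    using c2 unfolding N2 by (subst (asm) card_insert_disjoint) auto
  have d4: "distinct q4" using Suc.prems(1) q(1) q2(1) by simp
  from Suc.IH[OF d4 c4] obtain segs where segs: "length segs = r" "distinct (concat segs)"
      "set (concat segs) \<subseteq> set q4"
      "\<forall>s\<in>set segs. length s \<ge> 2 \<and> hd s \<in> N \<and> last s \<in> N \<and> set s \<inter> N \<subseteq> {hd s, last s} \<and>
       set (walk_arcs s) \<subseteq> set (walk_arcs q4)"
    by blast
  define s where "s = a # q3 @ [b]"
  have qs: "q = (q1 @ s) @ q4" using q(1) q2(1) by (simp add: s_def)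
  have "set (walk_arcs s) \<subseteq> set (walk_arcs q)" "set (walk_arcs q4) \<subseteq> set (walk_arcs q)"
    unfolding qs using walk_arcs_suffix_subset walk_arcs_prefix_subset by blast+
  moreover have "distinct s" "set s \<inter> set q4 = {}" "set s \<subseteq> set q" "set q4 \<subseteq> set q"
    using Suc.prems(1) unfolding qs by auto
  moreover have "set s \<inter> N \<subseteq> {hd s, last s}" "hd s \<in> N" "last s \<in> N" "length s \<ge> 2"
    using q(2) q2(2,3) by (auto simp: s_def)
  moreover have "set (walk_arcs t) \<subseteq> set (walk_arcs q)" if "t \<in> set (s # segs)" for t
    using that segs(4) calculation(1,2) by fastforce
  ultimately show ?case
    using segs by (intro exI[of _ "s # segs"] conjI ballI) auto
qed

lemma set_closed_walk:
  assumes "s \<noteq> []"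
  shows "set (walk_arcs (x # s @ [x])) = insert (x, hd s) (insert (last s, x) (set (walk_arcs s)))"
proof -
  obtain s' y where s: "s = s' @ [y]" using assms by (cases s rule: rev_cases) auto
  have 1: "walk_arcs (x # s @ [x]) = (x, hd s) # walk_arcs (s @ [x])"
    using assms by (cases s) auto
  have 2: "walk_arcs (s @ [x]) = walk_arcs s @ [(y, x)]"
    unfolding s using walk_arcs_append[of s' y "[x]"] by simp
  show ?thesis unfolding 1 2 by (auto simp: s)
qed

lemma walk_arcs_in_set: "(a, b) \<in> set (walk_arcs s) \<Longrightarrow> a \<in> set s \<and> b \<in> set s"
  by (induction s rule: walk_arcs.induct) auto

lemma closed_walk_dicycle:
  assumes "v \<notin> set s" "distinct s" "length s \<ge> 2" "(v, hd s) \<in> R" "(last s, v) \<in> R"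
    "set (walk_arcs s) \<subseteq> R"
  shows "dicycle R (walk_arcs (v # s @ [v]))"
proof -
  have "s \<noteq> []" using assms(3) by auto
  then have "set (walk_arcs (v # s @ [v])) \<subseteq> R"
    using assms(4-6) unfolding set_closed_walk[OF \<open>s \<noteq> []\<close>] by simp
  then show ?thesis
    unfolding dicycle_def using assms(1-3) by (intro exI[of _ v] exI[of _ s]) auto
qed

text \<open>The first vertex of a longest path has two neighbours on the path; the segment between them is closed
to a cycle through this vertex.\<close>

lemma dicycle_exists:
  assumes "finite R" "sym R" "irrefl R" "R \<noteq> {}" "\<And>v. v \<in> Domain R \<Longrightarrow> card (R `` {v}) \<ge> 2"
  shows "\<exists>C. dicycle R C"
proof -
  have fin: "finite (Domain R)" using assms(1) by (simp add: finite_Domain)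
  obtain w where w: "w \<in> Domain R" using assms(4) by auto
  have R: "R \<subseteq> Domain R \<times> Domain R" using assms(2) by (auto dest: symD)
  obtain v q where vq: "distinct (v # q)" "set (v # q) \<subseteq> Domain R" "set (walk_arcs (v # q)) \<subseteq> R"
      "R `` {v} \<subseteq> set q"
    using longest_path[OF fin w R assms(2,3)] by blast
  have "card (R `` {v} \<inter> set q) \<ge> 2 * 1"
    using assms(5)[of v] vq(2,4) by (simp add: Int_absorb2)
  moreover have "distinct q" using vq(1) by simp
  ultimately obtain segs where segs: "length segs = 1" "distinct (concat segs)" "set (concat segs) \<subseteq> set q"
    "\<forall>s\<in>set segs. length s \<ge> 2 \<and> hd s \<in> R `` {v} \<and> last s \<in> R `` {v} \<and>
       set s \<inter> R `` {v} \<subseteq> {hd s, last s} \<and> set (walk_arcs s) \<subseteq> set (walk_arcs q)"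
    using disjoint_segments[of q 1 "R `` {v}"] by metis
  from segs(1) obtain s where s: "segs = [s]"
    by (auto simp: length_Suc_conv)
  have "dicycle R (walk_arcs (v # s @ [v]))"
  proof (rule closed_walk_dicycle)
    show "v \<notin> set s" using segs(3) vq(1) s by auto
    show "distinct s" "length s \<ge> 2" "(v, hd s) \<in> R" using segs(2,4) s by auto
    show "(last s, v) \<in> R" using segs(4) s assms(2) by (auto dest: symD)
    have "set (walk_arcs q) \<subseteq> R"
      using vq(3) walk_arcs_suffix_subset[of q "[v]"] by auto
    then show "set (walk_arcs s) \<subseteq> R" using segs(4) s by auto
  qed
  then show ?thesis ..
qed

section \<open>Labellings without very negative sums\<close>

text \<open>The induction removes the highest labels. A pendant edge is oriented away from its pendant vertex: that
vertex has no other edge and gets exactly minus the highest label, while the other end only gains. If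
nothing is pendant, there is a directed cycle; with the highest labels it lowers each sum by at most
one, and it has more than one arc.\<close>

lemma low_labelling:
  assumes "finite R" "sym R" "irrefl R"
  shows "\<exists>ws. distinct ws \<and> orients (set ws) R \<and> (\<forall>v. lsum 0 ws v \<ge> - int (length ws))"
  using assms
proof (induction "card R" arbitrary: R rule: less_induct)
  case less
  consider "R = {}" | v w where "R `` {v} = {w}"
    | "R \<noteq> {}" "\<And>v. v \<in> Domain R \<Longrightarrow> card (R `` {v}) \<ge> 2"
  proof -
    have "card (R `` {v}) \<ge> 2" if "\<nexists>v w. R `` {v} = {w}" "v \<in> Domain R" for v
    proof -
      have "finite (R `` {v})" using less.prems(1) by (rule finite_Image)
      moreover have "R `` {v} \<noteq> {}" using that(2) by auto
      ultimately have "card (R `` {v}) \<noteq> 0" by simp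
      moreover have "card (R `` {v}) \<noteq> 1" using that(1) by (metis card_1_singletonE)
      ultimately show ?thesis by linarith
    qed
    then show thesis using that by blast
  qed
  then show ?case
  proof cases
    case 1
    then show ?thesis by (intro exI[of _ "[]"]) (simp add: orients_def)
  next
    case (2 v w)
    have vw: "(v, w) \<in> R" "(w, v) \<in> R" "v \<noteq> w"
      using 2 less.prems by (auto dest: symD simp: irrefl_def)
    define R' where "R' = R - {(v, w), (w, v)}"
    have "sym R'" "irrefl R'" "finite R'"
      using less.prems by (auto simp: R'_def sym_def irrefl_def)
    moreover have "card R' < card R"
      using less.prems(1) vw by (intro psubset_card_mono) (auto simp: R'_def)
    ultimately obtain ws where ws: "distinct ws" "orients (set ws) R'" "\<And>v. lsum 0 ws v \<ge> - int (length ws)"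
      using less.hyps[of R'] by blast
    have sub: "set ws \<subseteq> R'" using ws(2) by (auto simp: orients_def)
    have noarc: "lsum 0 ws v = 0"
    proof (rule lsum_eq_0)
      fix e assume "e \<in> set ws"
      then have e: "e \<in> R" "e \<noteq> (v, w)" "e \<noteq> (w, v)" using sub by (auto simp: R'_def)
      then show "fst e \<noteq> v \<and> snd e \<noteq> v"
        using 2 less.prems(2) by (cases e) (auto dest: symD)
    qed
    have "orients (set ws \<union> {(v, w)}) (R' \<union> {(v, w), (w, v)})"
      using ws(2) vw(3) by (intro orients_Un) (auto simp: orients_def R'_def)
    moreover have "R' \<union> {(v, w), (w, v)} = R"
      using vw by (auto simp: R'_def)
    ultimately have "orients (set (ws @ [(v, w)])) R" by simp
    moreover have "distinct (ws @ [(v, w)])"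
      using ws(1) sub by (auto simp: R'_def)
    moreover have "lsum 0 (ws @ [(v, w)]) x \<ge> - int (length (ws @ [(v, w)]))" for x
      using ws(3)[of x] noarc vw(3) by (auto simp: lsum_append incidence_def)
    ultimately show ?thesis by blast
  next
    case 3
    then obtain C where C: "dicycle R C"
      using dicycle_exists[OF less.prems] by blast
    define R' where "R' = R - (set C \<union> (set C)\<inverse>)"
    have CR: "set C \<subseteq> R" "C \<noteq> []" "distinct C"
      using dicycle_subset[OF C] dicycle_nonempty[OF C] dicycle_distinct[OF C] by (auto simp: distinct_map)
    have "sym R'" "irrefl R'" "finite R'"
      using less.prems by (auto simp: R'_def sym_def irrefl_def)
    moreover have "card R' < card R"
      using less.prems(1) CR(1,2) by (intro psubset_card_mono) (auto simp: R'_def neq_Nil_conv)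
    ultimately obtain ws where ws: "distinct ws" "orients (set ws) R'" "\<And>v. lsum 0 ws v \<ge> - int (length ws)"
      using less.hyps[of R'] by blast
    have sub: "set ws \<subseteq> R'" using ws(2) by (auto simp: orients_def)
    have "orients (set ws \<union> set C) (R' \<union> (set C \<union> (set C)\<inverse>))"
      using ws(2) dicycle_asym[OF C] by (intro orients_Un) (auto simp: orients_def R'_def)
    moreover have "R' \<union> (set C \<union> (set C)\<inverse>) = R"
      using CR(1) less.prems(2) by (auto simp: R'_def dest: symD)
    ultimately have "orients (set (ws @ C)) R" by simp
    moreover have "distinct (ws @ C)"
      using ws(1) sub CR(3) by (auto simp: R'_def)
    moreover have "lsum 0 (ws @ C) x \<ge> - int (length (ws @ C))" for x
    proof -
      have "length C > 0" using CR(2) by simp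
      then show ?thesis
        using ws(3)[of x] dicycle_lsum_ge[OF C, of "length ws" x]
        unfolding lsum_append length_append add_0_left by linarith
    qed
    ultimately show ?thesis by blast
  qed
qed

section \<open>Many edge-disjoint cycles\<close>

text \<open>The segments are vertex-disjoint, so two cycles of the fan share only the vertex v and hence no edge.
The restriction on the arcs is the induction invariant behind this.\<close>

lemma fan_dicycles:
  assumes "distinct (concat segs)" "v \<notin> set (concat segs)"
    "\<And>s. s \<in> set segs \<Longrightarrow> length s \<ge> 2 \<and> (v, hd s) \<in> R \<and> (last s, v) \<in> R \<and> set (walk_arcs s) \<subseteq> R"
  shows "dicycles (R \<inter> {(a, b). {a, b} \<subseteq> insert v (set (concat segs)) \<and> {a, b} \<inter> set (concat segs) \<noteq> {}})
           (map (\<lambda>s. walk_arcs (v # s @ [v])) segs)"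
  using assms
proof (induction segs)
  case Nil
  show ?case by (simp add: dicycles_Nil)
next
  case (Cons s segs)
  define T where "T X = {(a, b). {a, b} \<subseteq> insert v X \<and> {a, b} \<inter> X \<noteq> {}}" for X
  define X where "X = set (concat segs)"
  define C where "C = walk_arcs (v # s @ [v])"
  have s: "length s \<ge> 2" "(v, hd s) \<in> R" "(last s, v) \<in> R" "set (walk_arcs s) \<subseteq> R"
    using Cons.prems(3)[of s] by auto
  have ne: "s \<noteq> []" using s(1) by auto
  have disj: "set s \<inter> X = {}" "v \<notin> set s" "v \<notin> X" "distinct s"
    using Cons.prems(1,2) by (auto simp: X_def)
  have sT: "set (walk_arcs s) \<subseteq> T (set s)" "(v, hd s) \<in> T (set s)" "(last s, v) \<in> T (set s)"
    using ne by (auto simp: T_def dest: walk_arcs_in_set)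
  have "dicycle (R \<inter> T (set s)) C"
    unfolding C_def using s sT disj by (intro closed_walk_dicycle) auto
  then have C: "dicycle (R \<inter> T (set s \<union> X)) C" "set C \<subseteq> T (set s)"
    using dicycle_subset by (auto elim!: dicycle_mono simp: T_def)
  have "(set C)\<inverse> \<subseteq> T (set s)" using C(2) by (auto simp: T_def)
  moreover have "T X \<inter> T (set s) = {}"
    using disj by (auto simp: T_def)
  moreover have "T X \<subseteq> T (set s \<union> X)" by (auto simp: T_def)
  ultimately have sub: "R \<inter> T X \<subseteq> R \<inter> T (set s \<union> X) - (set C \<union> (set C)\<inverse>)"
    using C(2) by blast
  have "dicycles (R \<inter> T X) (map (\<lambda>s. walk_arcs (v # s @ [v])) segs)"
    unfolding T_def X_def using Cons.prems by (intro Cons.IH) auto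
  then have "dicycles (R \<inter> T (set s \<union> X) - (set C \<union> (set C)\<inverse>)) (map (\<lambda>s. walk_arcs (v # s @ [v])) segs)"
    using sub by (rule dicycles_mono)
  from dicycles_Cons[OF C(1) this] have "dicycles (R \<inter> T (set s \<union> X)) (C # map (\<lambda>s. walk_arcs (v # s @ [v])) segs)" .
  then show ?case by (simp add: T_def X_def C_def)
qed

lemma card_out_neighbours_le_1:
  assumes "distinct (map fst C)"
  shows "card {y. (w, y) \<in> set C} \<le> 1"
proof -
  have fin: "finite {y. (w, y) \<in> set C}"
    by (rule finite_subset[of _ "snd ` set C"]) (auto intro: rev_image_eqI)
  have "inj_on fst (set C)" using assms by (simp add: distinct_map)
  then have "\<forall>y\<in>{y. (w, y) \<in> set C}. \<forall>z\<in>{y. (w, y) \<in> set C}. y = z"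
    unfolding inj_on_def by force
  then show ?thesis using fin by (simp add: card_le_Suc0_iff_eq)
qed

lemma card_in_neighbours_le_1:
  assumes "distinct (map snd C)"
  shows "card {y. (y, w) \<in> set C} \<le> 1"
proof -
  have fin: "finite {y. (y, w) \<in> set C}"
    by (rule finite_subset[of _ "fst ` set C"]) (auto intro: rev_image_eqI)
  have "inj_on snd (set C)" using assms by (simp add: distinct_map)
  then have "\<forall>y\<in>{y. (y, w) \<in> set C}. \<forall>z\<in>{y. (y, w) \<in> set C}. y = z"
    unfolding inj_on_def by force
  then show ?thesis using fin by (simp add: card_le_Suc0_iff_eq)
qed

text \<open>The vertex v begins a longest path, so all its neighbours lie on the path and, in the order of the
path, two successive ones bound a cycle through v. Removing v and the fan of r such cycles costs every
other vertex at most two neighbours: a vertex on a cycle loses its two cycle edges, and an edge to v is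
one of them if it exists; any other vertex loses at most the edge to v.\<close>

lemma fan_of_cycles:
  assumes "finite W" "W \<noteq> {}" "R \<subseteq> W \<times> W" "sym R" "irrefl R"
    and deg: "\<And>w. w \<in> W \<Longrightarrow> card (R `` {w}) \<ge> 2 * r"
  shows "\<exists>v\<in>W. \<exists>Cs. length Cs = r \<and> dicycles R Cs \<and>
    (\<forall>w\<in>W - {v}. card (R `` {w}) \<le> card ((R - (set (concat Cs) \<union> (set (concat Cs))\<inverse>)) `` {w} - {v}) + 2)"
proof -
  obtain w0 where w0: "w0 \<in> W" using assms(2) by auto
  obtain v q where vq: "distinct (v # q)" "set (v # q) \<subseteq> W" "set (walk_arcs (v # q)) \<subseteq> R"
      "R `` {v} \<subseteq> set q"
    using longest_path[OF assms(1) w0 assms(3-5)] by blast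
  have "v \<in> W" using vq(2) by simp
  then have "card (R `` {v} \<inter> set q) \<ge> 2 * r"
    using deg[of v] vq(4) by (simp add: Int_absorb2)
  moreover have "distinct q" using vq(1) by simp
  ultimately obtain segs where segs: "length segs = r" "distinct (concat segs)" "set (concat segs) \<subseteq> set q"
    "\<forall>s\<in>set segs. length s \<ge> 2 \<and> hd s \<in> R `` {v} \<and> last s \<in> R `` {v} \<and>
       set s \<inter> R `` {v} \<subseteq> {hd s, last s} \<and> set (walk_arcs s) \<subseteq> set (walk_arcs q)"
    using disjoint_segments[of q r "R `` {v}"] by metis
  define cyc where "cyc s = walk_arcs (v # s @ [v])" for s
  define Cs where "Cs = map cyc segs"
  define E where "E = set (concat Cs)"
  have vnot: "v \<notin> set (concat segs)" using segs(3) vq(1) by auto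
  have qR: "set (walk_arcs q) \<subseteq> R"
    using vq(3) walk_arcs_suffix_subset[of q "[v]"] by auto
  have segR: "length s \<ge> 2 \<and> (v, hd s) \<in> R \<and> (last s, v) \<in> R \<and> set (walk_arcs s) \<subseteq> R"
    if "s \<in> set segs" for s
    using segs(4) that qR assms(4) by (auto dest: symD)
  have dic: "dicycles R Cs"
    unfolding Cs_def cyc_def
    by (rule dicycles_mono[OF fan_dicycles[OF segs(2) vnot segR]]) auto
  have cyc_set: "set (cyc s) = insert (v, hd s) (insert (last s, v) (set (walk_arcs s)))"
    if "s \<in> set segs" for s
    using segR[OF that] unfolding cyc_def by (intro set_closed_walk) auto
  have cyc_in: "a \<in> insert v (set s)" "b \<in> insert v (set s)"
    if "s \<in> set segs" "(a, b) \<in> set (cyc s)" for s a b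
    using that segR[OF that(1)] unfolding cyc_set[OF that(1)]
    by (auto dest: walk_arcs_in_set intro: hd_in_set last_in_set)
  have E: "e \<in> E \<longleftrightarrow> (\<exists>s\<in>set segs. e \<in> set (cyc s))" for e
    by (auto simp: E_def Cs_def)
  have "card (R `` {w}) \<le> card ((R - (E \<union> E\<inverse>)) `` {w} - {v}) + 2" if w: "w \<in> W - {v}" for w
  proof -
    define X where "X = R `` {w} - ((R - (E \<union> E\<inverse>)) `` {w} - {v})"
    have finR: "finite (R `` {w})"
      using assms(1,3) by (auto intro: finite_subset)
    have "card X \<le> 2"
    proof (cases "w \<in> set (concat segs)")
      case False
      have "(w, y) \<notin> E" "(y, w) \<notin> E" for y
        using False w cyc_in[of _ w y] cyc_in[of _ y w] unfolding E by auto
      then have "X \<subseteq> {v}" by (auto simp: X_def)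
      then have "card X \<le> card {v}" by (intro card_mono) auto
      then show ?thesis by simp
    next
      case True
      then obtain s where s: "s \<in> set segs" "w \<in> set s" by auto
      have uniq: "t = s" if "t \<in> set segs" "w \<in> set t" for t
        using segs(2) s that unfolding distinct_concat_iff by blast
      have out: "(w, y) \<in> set (cyc s)" if "(w, y) \<in> E" for y
        using that w cyc_in uniq unfolding E by blast
      have inn: "(y, w) \<in> set (cyc s)" if "(y, w) \<in> E" for y
        using that w cyc_in uniq unfolding E by blast
      have "(w, v) \<in> set (cyc s) \<or> (v, w) \<in> set (cyc s)" if "(w, v) \<in> R"
      proof -
        \<comment> \<open>neighbours of v occur only at the ends of a segment\<close>
        have "w \<in> R `` {v}" using that assms(4) by (auto dest: symD)
        then have "w = hd s \<or> w = last s" using segs(4) s by blast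
        then show ?thesis unfolding cyc_set[OF s(1)] by auto
      qed
      then have "X \<subseteq> {y. (w, y) \<in> set (cyc s)} \<union> {y. (y, w) \<in> set (cyc s)}"
        using out inn by (auto simp: X_def)
      moreover have "finite ({y. (w, y) \<in> set (cyc s)} \<union> {y. (y, w) \<in> set (cyc s)})"
        by (rule finite_subset[of _ "fst ` set (cyc s) \<union> snd ` set (cyc s)"]) (auto intro: rev_image_eqI)
      ultimately have "card X \<le> card ({y. (w, y) \<in> set (cyc s)} \<union> {y. (y, w) \<in> set (cyc s)})"
        by (intro card_mono)
      also have "\<dots> \<le> card {y. (w, y) \<in> set (cyc s)} + card {y. (y, w) \<in> set (cyc s)}"
        by (rule card_Un_le)
      also have "dicycle R (cyc s)"
        using dic s(1) by (simp add: dicycles_def Cs_def)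
      then have "card {y. (w, y) \<in> set (cyc s)} + card {y. (y, w) \<in> set (cyc s)} \<le> 1 + 1"
        using dicycle_distinct card_out_neighbours_le_1 card_in_neighbours_le_1 by (metis add_mono)
      finally show ?thesis by simp
    qed
    moreover have "card (R `` {w}) \<le> card ((R - (E \<union> E\<inverse>)) `` {w} - {v}) + card X"
    proof -
      have "R `` {w} = ((R - (E \<union> E\<inverse>)) `` {w} - {v}) \<union> X"
        by (auto simp: X_def)
      then show ?thesis by (metis card_Un_le)
    qed
    ultimately show ?thesis by linarith
  qed
  moreover have "length Cs = r" using segs(1) by (simp add: Cs_def)
  ultimately show ?thesis
    using \<open>v \<in> W\<close> dic unfolding E_def by blast
qed

text \<open>A fan of r cycles lowers the minimum degree by two, and the remaining graph provides a fan of r - 1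
cycles, and so on.\<close>

theorem edge_disjoint_cycles:
  assumes "finite W" "W \<noteq> {}" "R \<subseteq> W \<times> W" "sym R" "irrefl R"
    and "\<And>w. w \<in> W \<Longrightarrow> card (R `` {w}) \<ge> 2 * r + 1"
  shows "\<exists>Cs. length Cs = \<Sum>{..r} \<and> dicycles R Cs"
  using assms
proof (induction r arbitrary: W R)
  case 0
  show ?case by (intro exI[of _ "[]"]) (simp add: dicycles_Nil)
next
  case (Suc r)
  have deg: "card (R `` {w}) \<ge> 2 * Suc r" if "w \<in> W" for w
    using Suc.prems(6)[OF that] by simp
  obtain v Cs where v: "v \<in> W" and Cs: "length Cs = Suc r" "dicycles R Cs"
    "\<And>w. w \<in> W - {v} \<Longrightarrow> card (R `` {w}) \<le> card ((R - (set (concat Cs) \<union> (set (concat Cs))\<inverse>)) `` {w} - {v}) + 2"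
    using fan_of_cycles[OF Suc.prems(1-5) deg] by blast
  define Q where "Q = R - (set (concat Cs) \<union> (set (concat Cs))\<inverse>)"
  define R' where "R' = Q \<inter> (W - {v}) \<times> (W - {v})"
  have "sym Q" using Suc.prems(4) by (auto simp: Q_def sym_def)
  then have "sym R'" "irrefl R'"
    using Suc.prems(5) by (auto simp: R'_def Q_def sym_def irrefl_def)
  moreover have "card (R' `` {w}) \<ge> 2 * r + 1" if "w \<in> W - {v}" for w
  proof -
    have "R' `` {w} = Q `` {w} - {v}"
      using that Suc.prems(3) by (auto simp: R'_def Q_def)
    then show ?thesis
      using Cs(3)[OF that] Suc.prems(6)[of w] that by (simp add: Q_def)
  qed
  moreover have "W - {v} \<noteq> {}"
  proof -
    have "R `` {v} \<noteq> {}" using Suc.prems(6)[OF v] by (metis card.empty add_is_0 le_zero_eq one_neq_zero)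
    then show ?thesis using Suc.prems(3,5) by (auto simp: irrefl_def)
  qed
  ultimately obtain Ds where Ds: "length Ds = \<Sum>{..r}" "dicycles R' Ds"
    using Suc.IH[of "W - {v}" R'] Suc.prems(1) by (auto simp: R'_def)
  have "dicycles (R - (set (concat Cs) \<union> (set (concat Cs))\<inverse>)) Ds"
    using Ds(2) by (rule dicycles_mono) (auto simp: R'_def Q_def)
  then have "dicycles R (Cs @ Ds)"
    by (rule dicycles_append[OF Cs(2)])
  then show ?case
    using Cs(1) Ds(1) by (intro exI[of _ "Cs @ Ds"]) simp
qed

section \<open>Cycles forced by a small independence number\<close>

text \<open>If every vertex has at least two neighbours, there is a cycle. Otherwise a vertex with at most one neighbour is
deleted together with this neighbour. It could be added to every independent set of the rest, so the
bound k drops by one while only two vertices are lost.\<close>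

lemma cycle_if_few_independent:
  assumes "finite W" "sym R" "irrefl R" "card W \<ge> 2 * k + 1"
    and "\<And>X. X \<subseteq> W \<Longrightarrow> pairwise (\<lambda>u v. (u, v) \<notin> R) X \<Longrightarrow> card X \<le> k"
  shows "\<exists>C. dicycle (R \<inter> W \<times> W) C"
  using assms
proof (induction k arbitrary: W)
  case 0
  then obtain w where "w \<in> W" by fastforce
  then show ?case using "0.prems"(5)[of "{w}"] by (simp add: pairwise_def)
next
  case (Suc k)
  let ?R = "R \<inter> W \<times> W"
  have fin: "finite ?R" using Suc.prems(1) by auto
  show ?case
  proof (cases "\<exists>v\<in>W. card (?R `` {v}) \<le> 1")
    case True
    then obtain v where v: "v \<in> W" "card (?R `` {v}) \<le> 1" by blast
    define W' where "W' = W - insert v (?R `` {v})"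
    have "card W \<le> card W' + card (insert v (?R `` {v}))"
      unfolding W'_def by (metis Suc.prems(1) diff_card_le_card_Diff fin finite.insertI finite.emptyI finite_Image le_diff_conv)
    moreover have "card (insert v (?R `` {v})) \<le> 2"
      using v(2) fin by (simp add: card_insert_if finite_Image)
    ultimately have "card W' \<ge> 2 * k + 1" using Suc.prems(4) by simp
    moreover have "card X \<le> k" if X: "X \<subseteq> W'" "pairwise (\<lambda>u v. (u, v) \<notin> R) X" for X
    proof -
      have "finite X" using X(1) Suc.prems(1) by (auto simp: W'_def intro: finite_subset)
      moreover have "v \<notin> X" using X(1) by (auto simp: W'_def)
      moreover have "card (insert v X) \<le> Suc k"
      proof (rule Suc.prems(5))
        show "insert v X \<subseteq> W" using X(1) v(1) by (auto simp: W'_def)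
        have "(v, x) \<notin> R \<and> (x, v) \<notin> R" if "x \<in> X" for x
          using that X(1) v(1) Suc.prems(2) by (auto simp: W'_def dest: symD)
        then show "pairwise (\<lambda>u v. (u, v) \<notin> R) (insert v X)"
          using X(2) by (simp add: pairwise_insert)
      qed
      ultimately show ?thesis by simp
    qed
    ultimately obtain C where "dicycle (R \<inter> W' \<times> W') C"
      using Suc.IH[of W'] Suc.prems(1-3) by (auto simp: W'_def)
    then show ?thesis
      by (auto intro: dicycle_mono simp: W'_def)
  next
    case False
    have "W \<noteq> {}" using Suc.prems(4) by auto
    then have "?R \<noteq> {}" using False by fastforce
    moreover have "sym ?R" "irrefl ?R"
      using Suc.prems(2,3) by (auto simp: sym_def irrefl_def)
    moreover have "card (?R `` {v}) \<ge> 2" if "v \<in> Domain ?R" for v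
      using that False by fastforce
    ultimately show ?thesis
      using dicycle_exists[OF fin] by blast
  qed
qed

text \<open>This is the elementary bound for the Ramsey number of a triangle against an independent set of size
k + 1. If v has more than k neighbours, two of them are adjacent; otherwise few vertices are lost by
passing to the non-neighbours of v, and there the bound k drops by one.\<close>

lemma triangle_if_few_independent:
  assumes "finite W" "sym R" "irrefl R" "card W > \<Sum>{..Suc k} - 1"
    and "\<And>X. X \<subseteq> W \<Longrightarrow> pairwise (\<lambda>u v. (u, v) \<notin> R) X \<Longrightarrow> card X \<le> k"
  shows "\<exists>a\<in>W. \<exists>b\<in>W. \<exists>c\<in>W. (a, b) \<in> R \<and> (b, c) \<in> R \<and> (c, a) \<in> R"
  using assms
proof (induction k arbitrary: W)
  case 0
  then obtain w where "w \<in> W" by fastforce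
  then show ?case using "0.prems"(5)[of "{w}"] by (simp add: pairwise_def)
next
  case (Suc k)
  have "W \<noteq> {}" using Suc.prems(4) by auto
  then obtain v where v: "v \<in> W" by blast
  define N where "N = R `` {v} \<inter> W"
  have finN: "finite N" using Suc.prems(1) by (simp add: N_def)
  show ?case
  proof (cases "card N \<ge> k + 2")
    case True
    then have "\<not> pairwise (\<lambda>u v. (u, v) \<notin> R) N"
      using Suc.prems(5)[of N] by (auto simp: N_def)
    then obtain b c where "b \<in> N" "c \<in> N" "(b, c) \<in> R"
      by (auto simp: pairwise_def)
    then have "b \<in> W" "c \<in> W" "(v, b) \<in> R" "(b, c) \<in> R" "(c, v) \<in> R"
      using Suc.prems(2) by (auto simp: N_def dest: symD)
    then show ?thesis using v by blast
  next
    case False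
    define W' where "W' = W - insert v N"
    have "card W \<le> card W' + card (insert v N)"
      unfolding W'_def by (metis diff_card_le_card_Diff finN finite.insertI le_diff_conv)
    moreover have "card (insert v N) \<le> k + 2"
      using False finN by (simp add: card_insert_if)
    ultimately have "card W' > \<Sum>{..Suc k} - 1" using Suc.prems(4) by simp
    moreover have "card X \<le> k" if X: "X \<subseteq> W'" "pairwise (\<lambda>u v. (u, v) \<notin> R) X" for X
    proof -
      have "finite X" using X(1) Suc.prems(1) by (auto simp: W'_def intro: finite_subset)
      moreover have "v \<notin> X" using X(1) by (auto simp: W'_def)
      moreover have "card (insert v X) \<le> Suc k"
      proof (rule Suc.prems(5))
        show "insert v X \<subseteq> W" using X(1) v(1) by (auto simp: W'_def)
        have "(v, x) \<notin> R \<and> (x, v) \<notin> R" if "x \<in> X" for x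
          using that X(1) Suc.prems(2) by (auto simp: W'_def N_def dest: symD)
        then show "pairwise (\<lambda>u v. (u, v) \<notin> R) (insert v X)"
          using X(2) by (simp add: pairwise_insert)
      qed
      ultimately show ?thesis by simp
    qed
    ultimately obtain a b c where "a \<in> W'" "b \<in> W'" "c \<in> W'" "(a, b) \<in> R" "(b, c) \<in> R" "(c, a) \<in> R"
      using Suc.IH[of W'] Suc.prems(1-3) by (auto simp: W'_def)
    then show ?thesis by (auto simp: W'_def)
  qed
qed

text \<open>Ten vertices are what \<open>triangle_if_few_independent\<close> needs for k = 3, and the seven that remain after
removing a triangle are what \<open>cycle_if_few_independent\<close> needs for k = 3. The cycles have no
common vertex, so together they lower a sum by at most one.\<close>

lemma two_disjoint_cycles:
  assumes "finite W" "R \<subseteq> W \<times> W" "sym R" "irrefl R" "card W \<ge> 10"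
    and alpha: "\<And>X. X \<subseteq> W \<Longrightarrow> pairwise (\<lambda>u v. (u, v) \<notin> R) X \<Longrightarrow> card X \<le> 3"
  obtains C D where "dicycles R [C, D]" "\<And>v. lsum 0 C v + lsum 0 D v \<ge> - 1"
proof -
  have "\<Sum>{..Suc 3} - 1 < (card W :: nat)"
    using assms(5) by (simp add: numeral_eq_Suc)
  from triangle_if_few_independent[OF assms(1,3,4) this alpha]
  obtain a b c where abc: "a \<in> W" "b \<in> W" "c \<in> W" "(a, b) \<in> R" "(b, c) \<in> R" "(c, a) \<in> R"
    by blast
  have ne: "a \<noteq> b" "b \<noteq> c" "c \<noteq> a" using abc assms(4) by (auto simp: irrefl_def)
  define C where "C = walk_arcs (a # [b, c] @ [a])"
  have C: "dicycle R C"
    unfolding C_def using abc ne by (intro closed_walk_dicycle) auto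
  define W' where "W' = W - {a, b, c}"
  have "card W' = card W - 3"
    using assms(1) abc ne unfolding W'_def by (subst card_Diff_subset) auto
  then have "card W' \<ge> 2 * 3 + 1" using assms(5) by simp
  moreover have "finite W'" using assms(1) by (simp add: W'_def)
  ultimately obtain D where D: "dicycle (R \<inter> W' \<times> W') D"
    using cycle_if_few_independent[of W' R 3] assms(3,4) alpha by (auto simp: W'_def)
  have Cset: "set C = {(a, b), (b, c), (c, a)}" by (auto simp: C_def)
  have Dset: "set D \<subseteq> W' \<times> W'" using dicycle_subset[OF D] by auto
  have "dicycle (R - (set C \<union> (set C)\<inverse>)) D"
    by (rule dicycle_mono[OF D]) (auto simp: Cset W'_def)
  then have "dicycles (R - (set C \<union> (set C)\<inverse>)) [D]"
    by (intro dicycles_Cons dicycles_Nil)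
  then have "dicycles R [C, D]" by (rule dicycles_Cons[OF C])
  moreover have "lsum 0 C v + lsum 0 D v \<ge> - 1" for v
  proof (cases "v \<in> W'")
    case True
    then have "lsum 0 C v = 0"
      by (intro lsum_eq_0) (auto simp: Cset W'_def)
    then show ?thesis using dicycle_lsum_ge[OF D, of 0 v] by simp
  next
    case False
    then have "lsum 0 D v = 0"
      using Dset by (intro lsum_eq_0) auto
    then show ?thesis using dicycle_lsum_ge[OF C, of 0 v] by simp
  qed
  ultimately show ?thesis using that by blast
qed

section \<open>Star arcs interleaved with other arcs\<close>

text \<open>The segment seg i is placed directly below the i-th star arc. The labels of the segments depend only on
their lengths and not on which star arc occupies which place. So the sums without the star arcs can be
computed first and the star arcs sorted afterwards.\<close>

primrec weave :: "(nat \<Rightarrow> 'e list) \<Rightarrow> (nat \<Rightarrow> 'e) \<Rightarrow> nat \<Rightarrow> 'e list" where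
  "weave seg star 0 = []"
| "weave seg star (Suc n) = weave seg star n @ seg n @ [star n]"

definition star_pos :: "(nat \<Rightarrow> 'e list) \<Rightarrow> nat \<Rightarrow> nat" where
  "star_pos seg i = i + (\<Sum>l\<le>i. length (seg l))"

definition seg_start :: "(nat \<Rightarrow> 'e list) \<Rightarrow> nat \<Rightarrow> nat" where
  "seg_start seg i = i + (\<Sum>l<i. length (seg l))"

lemma star_pos_eq: "star_pos seg i = seg_start seg i + length (seg i)"
  by (simp add: star_pos_def seg_start_def flip: lessThan_Suc_atMost)

lemma length_weave: "length (weave seg star n) = seg_start seg n"
  by (induction n) (auto simp: seg_start_def)

lemma mset_weave:
  "mset (weave seg star n) = mset (concat (map seg [0..<n])) + mset (map star [0..<n])"
  by (induction n) auto

lemma lsum_weave: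
  "lsum b (weave seg star n) v =
     (\<Sum>i<n. int (b + star_pos seg i + 1) * incidence (star i) v) +
     (\<Sum>i<n. lsum (b + seg_start seg i) (seg i) v)"
  by (induction n) (auto simp: lsum_append length_weave star_pos_eq algebra_simps)

definition arrangement ::
    "('a \<times> 'a) list \<Rightarrow> (nat \<Rightarrow> ('a \<times> 'a) list) \<Rightarrow> ('a \<Rightarrow> 'a) \<Rightarrow> 'a list \<Rightarrow> ('a \<times> 'a) list" where
  "arrangement base seg f us =
     base @ weave seg (\<lambda>i. (f (us ! i), us ! i)) (length us) @ seg (length us)"

text \<open>What a vertex receives from all arcs except the star arcs. Here n is the number of star arcs.\<close>

definition partial_sum ::
    "('a \<times> 'a) list \<Rightarrow> (nat \<Rightarrow> ('a \<times> 'a) list) \<Rightarrow> nat \<Rightarrow> 'a \<Rightarrow> int" where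
  "partial_sum base seg n v =
     lsum 0 base v + (\<Sum>i\<le>n. lsum (length base + seg_start seg i) (seg i) v)"

lemma mset_arrangement:
  "mset (arrangement base seg f us) =
     mset base + mset (concat (map seg [0..<Suc (length us)])) + mset (map (\<lambda>u. (f u, u)) us)"
proof -
  have "map (\<lambda>i. (f (us ! i), us ! i)) [0..<length us] = map (\<lambda>u. (f u, u)) us"
    by (intro nth_equalityI) auto
  then show ?thesis by (simp add: arrangement_def mset_weave)
qed

lemma lsum_arrangement:
  "lsum 0 (arrangement base seg f us) v =
     partial_sum base seg (length us) v +
     (\<Sum>i<length us. int (length base + star_pos seg i + 1) * incidence (f (us ! i), us ! i) v)"
  by (simp add: arrangement_def partial_sum_def lsum_append lsum_weave length_weave
      flip: lessThan_Suc_atMost)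

lemma lsum_arrangement_leaf:
  assumes "distinct us" "\<And>u. u \<in> set us \<Longrightarrow> f u \<notin> set us" "j < length us"
  shows "lsum 0 (arrangement base seg f us) (us ! j) =
    partial_sum base seg (length us) (us ! j) + int (length base + star_pos seg j + 1)"
proof -
  have "f (us ! i) \<noteq> us ! j" if "i < length us" for i
    using assms that by (metis nth_mem)
  then have "incidence (f (us ! i), us ! i) (us ! j) = (if i = j then 1 else 0)" if "i < length us" for i
    using assms that by (auto simp: incidence_def nth_eq_iff_index_eq)
  then have "(\<Sum>i<length us. int (length base + star_pos seg i + 1) * incidence (f (us ! i), us ! i) (us ! j)) =
      (\<Sum>i<length us. if i = j then int (length base + star_pos seg j + 1) else 0)"
    by (intro sum.cong) auto
  also have "\<dots> = int (length base + star_pos seg j + 1)"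
    using assms(3) by (simp add: sum.delta')
  finally show ?thesis by (simp only: lsum_arrangement)
qed

lemma lsum_arrangement_centre:
  assumes "x \<notin> set us"
  shows "lsum 0 (arrangement base seg f us) x =
    partial_sum base seg (length us) x -
      (\<Sum>i<length us. if f (us ! i) = x then int (length base + star_pos seg i + 1) else 0)"
proof -
  have "us ! i \<noteq> x" if "i < length us" for i using assms that by auto
  then have "(\<Sum>i<length us. int (length base + star_pos seg i + 1) * incidence (f (us ! i), us ! i) x) =
      (\<Sum>i<length us. - (if f (us ! i) = x then int (length base + star_pos seg i + 1) else 0))"
    by (intro sum.cong) (auto simp: incidence_def)
  then show ?thesis by (simp add: lsum_arrangement sum_negf)
qed

lemma star_pos_strict_mono: "i < j \<Longrightarrow> star_pos seg i < star_pos seg j"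
proof -
  assume "i < j"
  then have "(\<Sum>l\<le>i. length (seg l)) \<le> (\<Sum>l\<le>j. length (seg l))"
    by (intro sum_mono2) auto
  with \<open>i < j\<close> show ?thesis by (simp add: star_pos_def)
qed

text \<open>Along the list us the sums without star arcs do not decrease and the labels of the star arcs increase,
hence the sums of the leaves are strictly increasing. A centre has only outgoing arcs, so its sum is at
most minus its degree; the assumption called low keeps the leaves above this. What remains is
distinctness among the centres.\<close>

lemma antimagic_arrangement:
  fixes G :: "'a pair_pre_digraph" and base seg f us
  defines "ws \<equiv> arrangement base seg f us"
  assumes us: "distinct us" "pverts G = S \<union> set us" "S \<inter> set us = {}" "\<And>u. u \<in> set us \<Longrightarrow> f u \<in> S"
    and ws: "distinct ws" "orients (set ws) (parcs G)" "\<And>e. e \<in> set ws \<Longrightarrow> snd e \<notin> S"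
    and sorted: "sorted (map (partial_sum base seg (length us)) us)"
    and low: "\<And>u x. u \<in> set us \<Longrightarrow> x \<in> S \<Longrightarrow>
      - int (card (parcs G `` {x})) < partial_sum base seg (length us) u + int (length base) + 1"
    and inj: "inj_on (lsum 0 ws) S"
  shows "\<exists>D \<tau>. antimagic_orientation G D \<tau>"
proof (rule antimagic_of_list[OF ws(1,2)])
  have fnot: "f u \<notin> set us" if "u \<in> set us" for u using us that by auto
  have leaf: "lsum 0 ws (us ! j) =
      partial_sum base seg (length us) (us ! j) + int (length base + star_pos seg j + 1)"
    if "j < length us" for j
    unfolding ws_def using fnot that by (rule lsum_arrangement_leaf[OF us(1)])
  have mono: "lsum 0 ws (us ! i) < lsum 0 ws (us ! j)" if "i < j" "j < length us" for i j
  proof -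
    have "partial_sum base seg (length us) (us ! i) \<le> partial_sum base seg (length us) (us ! j)"
      using sorted_nth_mono[OF sorted, of i j] that by simp
    then show ?thesis
      using leaf[of i] leaf[of j] that star_pos_strict_mono[OF that(1), of seg] by simp
  qed
  have injU: "inj_on (lsum 0 ws) (set us)"
  proof (rule inj_onI)
    fix u v assume uv: "u \<in> set us" "v \<in> set us" "lsum 0 ws u = lsum 0 ws v"
    then obtain i j where "i < length us" "u = us ! i" "j < length us" "v = us ! j"
      by (metis in_set_conv_nth)
    then show "u = v" using uv(3) mono[of i j] mono[of j i] by (metis less_irrefl nat_neq_iff)
  qed
  have lt: "lsum 0 ws x < lsum 0 ws u" if xu: "x \<in> S" "u \<in> set us" for x u
  proof -
    obtain j where j: "j < length us" "u = us ! j" using xu(2) by (metis in_set_conv_nth)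
    have "{u. (x, u) \<in> set ws} = parcs G `` {x}"
      using ws(2,3) xu(1) by (auto simp: orients_def)
    moreover have "{e. fst e = x} \<inter> set ws = Pair x ` {u. (x, u) \<in> set ws}" by auto
    ultimately have "card ({e. fst e = x} \<inter> set ws) = card (parcs G `` {x})"
      by (simp add: card_image inj_on_def)
    then have c: "length (filter (\<lambda>e. fst e = x) ws) = card (parcs G `` {x})"
      using distinct_length_filter[OF ws(1)] by simp
    have "lsum 0 ws x \<le> - int (card (parcs G `` {x}))"
      unfolding c[symmetric] using ws(3) xu(1) by (intro lsum_le_if_no_in) auto
    also have "\<dots> < lsum 0 ws u"
      using low[OF xu(2,1)] leaf[OF j(1)] by (simp add: j(2))
    finally show ?thesis .
  qed
  have "y \<noteq> z" if "y \<in> lsum 0 ws ` (S - set us)" "z \<in> lsum 0 ws ` (set us - S)" for y z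
    using that by (elim imageE) (simp add: lt less_imp_neq)
  then have "lsum 0 ws ` (S - set us) \<inter> lsum 0 ws ` (set us - S) = {}" by blast
  then show "inj_on (lsum 0 ws) (pverts G)"
    using inj injU unfolding us(2) inj_on_Un by simp
qed

section \<open>Stars around an independent set\<close>

lemma pair_graph_sym: "pair_graph G \<Longrightarrow> (a, b) \<in> parcs G \<Longrightarrow> (b, a) \<in> parcs G"
  by (auto simp: pair_graph_def pair_pseudo_graph_def pair_sym_digraph_def
      pair_sym_digraph_axioms_def symmetric_def dest: symD)

lemma pair_graph_loopfree: "pair_graph G \<Longrightarrow> (a, a) \<notin> parcs G"
  by (fastforce simp: pair_graph_def pair_digraph_def pair_loopfree_digraph_def
      pair_loopfree_digraph_axioms_def)

lemma pair_graph_finite: "pair_graph G \<Longrightarrow> finite (pverts G)"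
  and pair_graph_finite_arcs: "pair_graph G \<Longrightarrow> finite (parcs G)"
  by (auto simp: pair_graph_def pair_digraph_def pair_fin_digraph_def pair_fin_digraph_axioms_def)

lemma pair_graph_verts: "pair_graph G \<Longrightarrow> (a, b) \<in> parcs G \<Longrightarrow> a \<in> pverts G \<and> b \<in> pverts G"
  by (fastforce simp: pair_graph_def pair_digraph_def pair_fin_digraph_def pair_wf_digraph_def)

text \<open>S is the set of centres and U the set of leaves; f u is the centre whose star arc adjusts the leaf u.\<close>

locale star_graph =
  fixes G :: "'a pair_pre_digraph" and S U :: "'a set" and f :: "'a \<Rightarrow> 'a"
  assumes graph: "pair_graph G"
    and independent: "independent_set G S"
    and U: "U = pverts G - S"
    and f: "u \<in> U \<Longrightarrow> f u \<in> S" "u \<in> U \<Longrightarrow> (f u, u) \<in> parcs G"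
begin

lemmas sym_parcs = pair_graph_sym[OF graph]
  and no_loop = pair_graph_loopfree[OF graph]
  and fin = pair_graph_finite[OF graph] pair_graph_finite_arcs[OF graph]
  and arcs_verts = pair_graph_verts[OF graph]

lemma S_subset: "S \<subseteq> pverts G"
  using independent by (simp add: independent_set_def)

lemma finS: "finite S" and finU: "finite U"
  using S_subset fin(1) by (auto simp: U intro: finite_subset)

lemma U_iff: "u \<in> U \<longleftrightarrow> u \<in> pverts G \<and> u \<notin> S"
  by (simp add: U)

lemma S_indep: "a \<in> S \<Longrightarrow> b \<in> S \<Longrightarrow> (a, b) \<notin> parcs G"
  using independent no_loop by (cases "a = b") (auto simp: independent_set_def pairwise_def)

definition "L = parcs G \<inter> U \<times> U"
definition "out_arcs_S = parcs G \<inter> S \<times> U"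
definition "star_arcs = (\<lambda>u. (f u, u)) ` U"

lemma finL: "finite L" and symL: "sym L" and irreflL: "irrefl L"
  using fin(2) sym_parcs no_loop by (auto simp: L_def sym_def irrefl_def)

lemma star_subset: "star_arcs \<subseteq> out_arcs_S"
  using f by (auto simp: star_arcs_def out_arcs_S_def)

lemma fin_out_arcs_S: "finite out_arcs_S"
  using fin(2) by (auto simp: out_arcs_S_def)

lemma out_arcs_of: "x \<in> S \<Longrightarrow> parcs G `` {x} = {u. (x, u) \<in> out_arcs_S}"
  using arcs_verts S_indep by (auto simp: out_arcs_S_def U_iff)

lemma orients_parcs:
  assumes "orients A L"
  shows "orients (A \<union> out_arcs_S) (parcs G)"
proof -
  have disj: "S \<inter> U = {}" by (auto simp: U_iff)
  have "orients out_arcs_S (out_arcs_S \<union> out_arcs_S\<inverse>)"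
    using disj by (auto simp: orients_def out_arcs_S_def)
  moreover have "L \<inter> (out_arcs_S \<union> out_arcs_S\<inverse>) = {}"
    using disj by (auto simp: L_def out_arcs_S_def)
  moreover have "L \<union> (out_arcs_S \<union> out_arcs_S\<inverse>) = parcs G"
  proof (rule set_eqI)
    fix e :: "'a \<times> 'a"
    obtain a b where e: "e = (a, b)" by (cases e)
    show "e \<in> L \<union> (out_arcs_S \<union> out_arcs_S\<inverse>) \<longleftrightarrow> e \<in> parcs G"
      using arcs_verts[of a b] sym_parcs[of a b] sym_parcs[of b a] S_indep[of a b]
      by (auto simp: e L_def out_arcs_S_def U_iff)
  qed
  ultimately show ?thesis
    using orients_Un[OF assms, of out_arcs_S] by metis
qed

lemma ex_sorted_leaves:
  obtains us where "distinct us" "set us = U" "sorted (map (P :: 'a \<Rightarrow> int) us)"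
proof -
  obtain us where "set us = U" "distinct us"
    using finite_distinct_list[OF finU] by blast
  then show ?thesis
    using that[of "sort_key P us"] by simp
qed

text \<open>Whatever the segments are, the arcs can be any list los that orients the edges among the leaves,
together with all arcs from centres to leaves that are not star arcs.\<close>

lemma antimagic_if_arranged:
  assumes us: "distinct us" "set us = U"
    and segs: "mset (base @ concat (map seg [0..<Suc (length us)])) = mset (los @ bl)"
    and lo: "distinct los" "orients (set los) L"
    and bl: "distinct bl" "set bl = out_arcs_S - star_arcs"
    and sorted: "sorted (map (partial_sum base seg (length us)) us)"
    and low: "\<And>u x. u \<in> U \<Longrightarrow> x \<in> S \<Longrightarrow>
      - int (card (parcs G `` {x})) < partial_sum base seg (length us) u + int (length base) + 1"
    and inj: "inj_on (lsum 0 (arrangement base seg f us)) S"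
  shows "\<exists>D \<tau>. antimagic_orientation G D \<tau>"
proof -
  let ?ws = "arrangement base seg f us"
  have loL: "set los \<subseteq> L" using lo(2) by (auto simp: orients_def)
  have m: "mset ?ws = mset (los @ bl @ map (\<lambda>u. (f u, u)) us)"
    using segs by (simp add: mset_arrangement del: upt_Suc)
  have s: "set ?ws = set los \<union> out_arcs_S"
  proof -
    have "set ?ws = set los \<union> set bl \<union> star_arcs"
      using arg_cong[OF m, of set_mset] us(2) by (auto simp: star_arcs_def)
    then show ?thesis using bl(2) star_subset by auto
  qed
  show ?thesis
  proof (rule antimagic_arrangement[OF us(1) _ _ _ _ _ _ sorted _ inj])
    show "pverts G = S \<union> set us" "S \<inter> set us = {}" using S_subset us(2) by (auto simp: U_iff)
    show "f u \<in> S" if "u \<in> set us" for u using f that us(2) by auto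
    have "distinct (los @ bl @ map (\<lambda>u. (f u, u)) us)"
    proof -
      have "set los \<inter> out_arcs_S = {}"
        using loL by (auto simp: L_def out_arcs_S_def U_iff)
      moreover have "(\<lambda>u. (f u, u)) ` set us = star_arcs" using us(2) by (simp add: star_arcs_def)
      ultimately show ?thesis
        using lo(1) bl us(1) star_subset by (auto simp: distinct_map inj_on_def)
    qed
    then show "distinct ?ws" using mset_eq_imp_distinct_iff[OF m] by simp
    show "orients (set ?ws) (parcs G)" unfolding s by (rule orients_parcs[OF lo(2)])
    show "snd e \<notin> S" if "e \<in> set ?ws" for e
      using that loL unfolding s by (auto simp: L_def out_arcs_S_def U_iff)
    show "- int (card (parcs G `` {x})) < partial_sum base seg (length us) u + int (length base) + 1"
      if "u \<in> set us" "x \<in> S" for u x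
      using low that us(2) by simp
  qed
qed

text \<open>Without segments nothing can be adjusted afterwards; this is used where the sizes of the labels already
tell the centres apart.\<close>

lemma plain_arrangement:
  obtains los bl us where "distinct us" "set us = U" "distinct los" "orients (set los) L"
    "distinct bl" "set bl = out_arcs_S - star_arcs"
    "inj_on (lsum 0 (los @ bl @ map (\<lambda>u. (f u, u)) us)) S \<Longrightarrow> \<exists>D \<tau>. antimagic_orientation G D \<tau>"
proof -
  obtain los where los: "distinct los" "orients (set los) L" "\<And>v. lsum 0 los v \<ge> - int (length los)"
    using low_labelling[OF finL symL irreflL] by blast
  obtain bl where bl: "distinct bl" "set bl = out_arcs_S - star_arcs"
    using finite_distinct_list[of "out_arcs_S - star_arcs"] fin_out_arcs_S by auto
  define seg where "seg = (\<lambda>i::nat. [] :: ('a \<times> 'a) list)"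
  obtain us where us: "distinct us" "set us = U" "sorted (map (partial_sum (los @ bl) seg (card U)) us)"
    using ex_sorted_leaves by blast
  have len: "length us = card U" using us(1,2) distinct_card by fastforce
  have w: "weave seg g n = map g [0..<n]" for g n
    by (induction n) (auto simp: seg_def)
  have segs: "concat (map seg [0..<n]) = []" for n by (simp add: seg_def)
  have arr: "arrangement (los @ bl) seg f us = los @ bl @ map (\<lambda>u. (f u, u)) us"
  proof -
    have "map (\<lambda>i. (f (us ! i), us ! i)) [0..<length us] = map (\<lambda>u. (f u, u)) us"
      by (intro nth_equalityI) auto
    then show ?thesis by (simp add: arrangement_def w) (simp add: seg_def)
  qed
  have low: "- int (card (parcs G `` {x})) < partial_sum (los @ bl) seg (length us) u + int (length (los @ bl)) + 1"
    if "u \<in> U" "x \<in> S" for u x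
  proof -
    have "fst e \<noteq> u" if "e \<in> set bl" for e
    proof -
      have "e \<in> out_arcs_S" using that unfolding bl(2) by (rule DiffD1)
      then have "fst e \<in> S" unfolding out_arcs_S_def by (cases e) simp
      then show ?thesis using \<open>u \<in> U\<close> unfolding U_iff by metis
    qed
    then have 1: "lsum (length los) bl u \<ge> 0"
      by (rule lsum_nonneg_if_no_out)
    have 2: "partial_sum (los @ bl) seg n u = lsum 0 los u + lsum (length los) bl u" for n
      unfolding partial_sum_def seg_def lsum_append by simp
    have 3: "int (length los) \<le> int (length (los @ bl))" "0 \<le> int (card (parcs G `` {x}))"
      by simp_all
    show ?thesis
      unfolding 2 using 1 3 los(3)[of u] by linarith
  qed
  have "\<exists>D \<tau>. antimagic_orientation G D \<tau>"
    if inj: "inj_on (lsum 0 (los @ bl @ map (\<lambda>u. (f u, u)) us)) S"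
  proof (rule antimagic_if_arranged[where base = "los @ bl" and seg = seg, OF us(1,2) _ los(1,2) bl _ low])
    show "mset ((los @ bl) @ concat (map seg [0..<Suc (length us)])) = mset (los @ bl)"
      by (simp only: segs append_Nil2)
    show "sorted (map (partial_sum (los @ bl) seg (length us)) us)"
      using us(3) by (simp only: len)
    show "inj_on (lsum 0 (arrangement (los @ bl) seg f us)) S"
      using inj by (simp only: arr)
  qed
  then show ?thesis using that us(1,2) los(1,2) bl by blast
qed

end

section \<open>Moving cycles past star arcs\<close>

text \<open>A pair (C, j) places the list C directly below the star arc with index j, counted from 0, that is, above
the first j star arcs.\<close>

definition seg_of :: "('e list \<times> nat) list \<Rightarrow> nat \<Rightarrow> 'e list" where
  "seg_of Ps i = concat (map fst (filter (\<lambda>p. snd p = i) Ps))"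

lemma seg_of_Nil: "seg_of [] i = []"
  by (simp add: seg_of_def)

lemma seg_of_Cons: "seg_of (p # Ps) i = (if snd p = i then fst p else []) @ seg_of Ps i"
  by (simp add: seg_of_def)

lemma mset_concat_map: "mset (concat (map seg [0..<n])) = (\<Sum>i<n. mset (seg i))"
  by (induction n) auto

lemma mset_seg_of:
  assumes "\<And>p. p \<in> set Ps \<Longrightarrow> snd p \<le> n"
  shows "mset (concat (map (seg_of Ps) [0..<Suc n])) = mset (concat (map fst Ps))"
  unfolding mset_concat_map using assms
proof (induction Ps)
  case (Cons p Ps)
  have "(\<Sum>i<Suc n. mset (seg_of (p # Ps) i)) =
      (\<Sum>i<Suc n. if i = snd p then mset (fst p) else {#}) + (\<Sum>i<Suc n. mset (seg_of Ps i))"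
    unfolding sum.distrib[symmetric] by (intro sum.cong) (auto simp: seg_of_Cons)
  also have "(\<Sum>i<Suc n. if i = snd p then mset (fst p) else {#}) = mset (fst p)"
    using Cons.prems[of p] by (subst sum.delta) auto
  finally show ?case using Cons by simp
qed (simp add: seg_of_Nil)

lemma star_pos_seg_of:
  "star_pos (seg_of Ps) i = i + (\<Sum>p\<leftarrow>Ps. if snd p \<le> i then length (fst p) else 0)"
proof -
  have "(\<Sum>l\<le>i. length (seg_of Ps l)) = (\<Sum>p\<leftarrow>Ps. if snd p \<le> i then length (fst p) else 0)"
  proof (induction Ps)
    case (Cons p Ps)
    have "(\<Sum>l\<le>i. length (seg_of (p # Ps) l)) =
        (\<Sum>l\<le>i. if l = snd p then length (fst p) else 0) + (\<Sum>l\<le>i. length (seg_of Ps l))"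
      unfolding sum.distrib[symmetric] by (intro sum.cong) (auto simp: seg_of_Cons)
    also have "(\<Sum>l\<le>i. if l = snd p then length (fst p) else 0) = (if snd p \<le> i then length (fst p) else 0)"
      by (subst sum.delta) auto
    finally show ?case using Cons by simp
  qed (simp add: seg_of_Nil)
  then show ?thesis by (simp add: star_pos_def)
qed

lemma lsum_seg_of:
  assumes "\<And>p b b' v. p \<in> set Ps \<Longrightarrow> lsum b (fst p) v = lsum b' (fst p) v"
  shows "lsum b (seg_of Ps i) v = (\<Sum>p\<leftarrow>Ps. if snd p = i then lsum 0 (fst p) v else 0)"
  using assms
proof (induction Ps arbitrary: b)
  case (Cons p Ps)
  have "lsum b (fst p) v = lsum 0 (fst p) v" for b by (rule Cons.prems) simp
  moreover have "lsum b (seg_of Ps i) v = (\<Sum>p\<leftarrow>Ps. if snd p = i then lsum 0 (fst p) v else 0)" for b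
    by (rule Cons.IH) (rule Cons.prems, simp)
  ultimately show ?case by (simp add: seg_of_Cons lsum_append)
qed (simp add: seg_of_Nil)

lemma partial_sum_seg_of:
  assumes "\<And>p b b' v. p \<in> set Ps \<Longrightarrow> lsum b (fst p) v = lsum b' (fst p) v"
    and "\<And>p. p \<in> set Ps \<Longrightarrow> snd p \<le> n"
  shows "partial_sum base (seg_of Ps) n v = lsum 0 base v + (\<Sum>p\<leftarrow>Ps. lsum 0 (fst p) v)"
proof -
  have "(\<Sum>i\<le>n. \<Sum>p\<leftarrow>Ps. if snd p = i then g p else (0::int)) = (\<Sum>p\<leftarrow>Ps. g p)" for g
    using assms(2)
  proof (induction Ps)
    case (Cons p Ps)
    have "(\<Sum>i\<le>n. if snd p = i then g p else 0) = g p"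
      using Cons.prems[of p] by (subst sum.delta') auto
    then show ?case using Cons by (simp add: sum.distrib)
  qed simp
  moreover have "lsum b (seg_of Ps i) v = (\<Sum>p\<leftarrow>Ps. if snd p = i then lsum 0 (fst p) v else 0)" for b i
    using assms(1) by (rule lsum_seg_of)
  ultimately show ?thesis by (simp add: partial_sum_def)
qed

text \<open>The list fs contains the centres of the star arcs in the order of their labels. An arc is raised by a
cycle placed below position j precisely if its own position is at least j.\<close>

lemma count_list_take_add:
  "count_list (take j fs) x + (\<Sum>i<length fs. if fs ! i = x \<and> j \<le> i then 1 else 0) = count_list fs x"
proof (induction fs arbitrary: j)
  case (Cons a fs)
  have e: "(\<Sum>i<length (a # fs). if (a # fs) ! i = x \<and> j \<le> i then 1 else 0 :: nat) =
     (if a = x \<and> j = 0 then 1 else 0) + (\<Sum>i<length fs. if fs ! i = x \<and> j \<le> Suc i then 1 else 0)"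
    by (simp add: sum.lessThan_Suc_shift del: sum.lessThan_Suc)
  show ?case
  proof (cases j)
    case 0
    then show ?thesis using Cons.IH[of 0] e by (cases "a = x") (auto simp del: sum.lessThan_Suc)
  next
    case (Suc j')
    then show ?thesis using Cons.IH[of j'] e by (cases "a = x") (auto simp del: sum.lessThan_Suc)
  qed
qed simp

text \<open>On the left is what the cycles add to the labels of the star arcs of x. A cycle raises every star arc of
x except those that it has been moved past, the number of which is the subtracted count.\<close>

lemma centre_shift:
  "(\<Sum>i<length fs. if fs ! i = x then int (\<Sum>p\<leftarrow>Ps. if snd p \<le> i then length (fst p) else 0) else 0) =
   (\<Sum>p\<leftarrow>Ps. int (length (fst p)) * int (count_list fs x)) -
   (\<Sum>p\<leftarrow>Ps. int (length (fst p) * count_list (take (snd p) fs) x))"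
proof (induction Ps)
  case (Cons p Ps)
  have "(\<Sum>i<length fs. if fs ! i = x then int (\<Sum>p\<leftarrow>p # Ps. if snd p \<le> i then length (fst p) else 0) else 0) =
     (\<Sum>i<length fs. int (length (fst p)) * (if fs ! i = x \<and> snd p \<le> i then 1 else 0)) +
     (\<Sum>i<length fs. if fs ! i = x then int (\<Sum>p\<leftarrow>Ps. if snd p \<le> i then length (fst p) else 0) else 0)"
    unfolding sum.distrib[symmetric] by (intro sum.cong) auto
  also have "(\<Sum>i<length fs. int (length (fst p)) * (if fs ! i = x \<and> snd p \<le> i then 1 else 0)) =
     int (length (fst p)) * int (\<Sum>i<length fs. if fs ! i = x \<and> snd p \<le> i then 1 else 0)"
    unfolding sum_distrib_left[symmetric] by (simp only: of_nat_sum if_distrib of_nat_1 of_nat_0)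
  also have "int (\<Sum>i<length fs. if fs ! i = x \<and> snd p \<le> i then 1 else 0) =
     int (count_list fs x) - int (count_list (take (snd p) fs) x)"
    using count_list_take_add[of "snd p" fs x] by linarith
  finally show ?case
    unfolding Cons.IH by (simp add: algebra_simps)
qed (simp cong: if_cong)

text \<open>The change of the sum of the centre x if cycles of lengths qs, initially below all star arcs, are moved
past the first j of them, where j runs through js.\<close>

definition shift :: "nat list \<Rightarrow> nat list \<Rightarrow> 'a list \<Rightarrow> 'a \<Rightarrow> int" where
  "shift qs js fs x = (\<Sum>p\<leftarrow>zip qs js. int (fst p * count_list (take (snd p) fs) x))"

text \<open>The initial sums c and the order fs of the star arcs result from the labels of the remaining arcs, so
that the lengths qs have to work for all c and fs.\<close>

definition separating :: "nat list \<Rightarrow> 'a set \<Rightarrow> bool" where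
  "separating qs S \<longleftrightarrow> (\<forall>fs c. set fs = S \<longrightarrow>
     (\<exists>js. length js = length qs \<and> (\<forall>j\<in>set js. j \<le> length fs) \<and>
       inj_on (\<lambda>x. c x + shift qs js fs x) S))"

context star_graph
begin

text \<open>The numbers js of star arcs that the cycles are moved past can be chosen after the leaves have been
sorted, since the sums without star arcs do not depend on js. A leaf gets at least minus the number of
edges with low labels, minus K from the cycles, and at least one more than that number from its star
arc; so degree K at the centres keeps the two kinds of vertices apart.\<close>

theorem antimagic_by_cycles:
  assumes surj: "f ` U = S"
    and cyc: "dicycles L Cs"
    and K: "\<And>v. (\<Sum>C\<leftarrow>Cs. lsum 0 C v) \<ge> - int K" "\<And>x. x \<in> S \<Longrightarrow> K \<le> card (parcs G `` {x})"
    and sep: "separating (map length Cs) S"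
  shows "\<exists>D \<tau>. antimagic_orientation G D \<tau>"
proof -
  define E where "E = set (concat Cs)"
  define L0 where "L0 = L - (E \<union> E\<inverse>)"
  have EL: "E \<subseteq> L" using dicycles_subset[OF cyc] by (simp add: E_def)
  have E: "E \<inter> E\<inverse> = {}" "distinct (concat Cs)" using cyc unfolding dicycles_def E_def by blast+
  have "finite L0" "sym L0" "irrefl L0"
    using finL symL irreflL by (auto simp: L0_def sym_def irrefl_def)
  then obtain lo where lo: "distinct lo" "orients (set lo) L0" "\<And>v. lsum 0 lo v \<ge> - int (length lo)"
    using low_labelling by blast
  have loL0: "set lo \<subseteq> L0" using lo(2) by (auto simp: orients_def)
  obtain bl where bl: "distinct bl" "set bl = out_arcs_S - star_arcs"
    using finite_distinct_list[of "out_arcs_S - star_arcs"] fin_out_arcs_S by auto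
  define base where "base = lo @ bl"
  have "distinct (lo @ concat Cs)"
    using lo(1) E(2) loL0 by (auto simp: L0_def E_def)
  moreover have "orients (set (lo @ concat Cs)) L"
  proof -
    have "orients (set lo \<union> E) (L0 \<union> (E \<union> E\<inverse>))"
      using lo(2) E(1) by (intro orients_Un) (auto simp: orients_def L0_def)
    moreover have "E\<inverse> \<subseteq> L" using EL symL by (auto dest: symD)
    then have "L0 \<union> (E \<union> E\<inverse>) = L" using EL by (auto simp: L0_def)
    ultimately show ?thesis by (simp add: E_def)
  qed
  \<comment> \<open>the sums without star arcs, by which the leaves are sorted\<close>
  moreover define P where "P v = lsum 0 base v + (\<Sum>C\<leftarrow>Cs. lsum 0 C v)" for v
  obtain us where us: "distinct us" "set us = U" "sorted (map P us)"
    using ex_sorted_leaves by blast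
  define fs where "fs = map f us"
  define k where "k x = lsum 0 base x + (\<Sum>C\<leftarrow>Cs. lsum 0 C x)
      - (\<Sum>i<length fs. if fs ! i = x then int (length base + i + 1) else 0)
      - (\<Sum>C\<leftarrow>Cs. int (length C) * int (count_list fs x))" for x
  have "set fs = S" using surj us(2) by (simp add: fs_def)
  then obtain js where js: "length js = length Cs" "\<And>j. j \<in> set js \<Longrightarrow> j \<le> length fs"
      "inj_on (\<lambda>x. k x + shift (map length Cs) js fs x) S"
    using sep unfolding separating_def by (metis length_map)
  define Ps where "Ps = zip Cs js"
  have fstPs: "map fst Ps = Cs" using js(1) by (simp add: Ps_def)
  have sndPs: "snd p \<le> length us" if "p \<in> set Ps" for p
  proof -
    have "(fst p, snd p) \<in> set (zip Cs js)" using that by (simp add: Ps_def)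
    then have "snd p \<in> set js" by (rule set_zip_rightD)
    then show ?thesis using js(2) by (simp add: fs_def)
  qed
  have bal: "lsum b (fst p) v = lsum b' (fst p) v" if "p \<in> set Ps" for p b b' v
  proof -
    have "(fst p, snd p) \<in> set (zip Cs js)" using that by (simp add: Ps_def)
    then have "fst p \<in> set Cs" by (rule set_zip_leftD)
    then have "dicycle L (fst p)" using cyc by (simp add: dicycles_def)
    then show ?thesis by (rule dicycle_lsum_shift)
  qed
  have sumPs: "(\<Sum>p\<leftarrow>Ps. g (fst p)) = (\<Sum>C\<leftarrow>Cs. g C)" for g :: "_ \<Rightarrow> int"
    unfolding fstPs[symmetric] by (simp add: comp_def)
  have part: "partial_sum base (seg_of Ps) (length us) v = P v" for v
  proof -
    have "partial_sum base (seg_of Ps) (length us) v = lsum 0 base v + (\<Sum>p\<leftarrow>Ps. lsum 0 (fst p) v)"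
      by (rule partial_sum_seg_of, erule bal, erule sndPs)
    then show ?thesis using sumPs[of "\<lambda>C. lsum 0 C v"] by (simp add: P_def)
  qed
  have ctr: "lsum 0 (arrangement base (seg_of Ps) f us) x = k x + shift (map length Cs) js fs x"
    if "x \<in> S" for x
  proof -
    have "x \<notin> set us" using that us(2) by (auto simp: U_iff)
    then have "lsum 0 (arrangement base (seg_of Ps) f us) x = P x -
        (\<Sum>i<length us. if f (us ! i) = x then int (length base + star_pos (seg_of Ps) i + 1) else 0)"
      unfolding part[symmetric] by (rule lsum_arrangement_centre)
    also have "(\<Sum>i<length us. if f (us ! i) = x then int (length base + star_pos (seg_of Ps) i + 1) else 0) =
        (\<Sum>i<length fs. if fs ! i = x then int (length base + i + 1) else 0) +
        (\<Sum>i<length fs. if fs ! i = x then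
           int (\<Sum>p\<leftarrow>Ps. if snd p \<le> i then length (fst p) else 0) else 0)"
      unfolding sum.distrib[symmetric] by (intro sum.cong) (auto simp: fs_def star_pos_seg_of)
    also note centre_shift
    also have "(\<Sum>p\<leftarrow>Ps. int (length (fst p)) * int (count_list fs x)) =
        (\<Sum>C\<leftarrow>Cs. int (length C) * int (count_list fs x))"
      by (rule sumPs)
    also have "(\<Sum>p\<leftarrow>Ps. int (length (fst p) * count_list (take (snd p) fs) x)) =
        shift (map length Cs) js fs x"
      by (simp add: shift_def Ps_def zip_map1 comp_def case_prod_unfold)
    finally show ?thesis by (simp add: k_def P_def)
  qed
  ultimately show ?thesis
  proof (intro antimagic_if_arranged[where base = base and seg = "seg_of Ps" and los = "lo @ concat Cs",
        OF us(1,2) _ _ _ bl])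
    show "mset (base @ concat (map (seg_of Ps) [0..<Suc (length us)])) = mset ((lo @ concat Cs) @ bl)"
    proof -
      have "mset (concat (map (seg_of Ps) [0..<Suc (length us)])) = mset (concat Cs)"
        unfolding fstPs[symmetric] by (rule mset_seg_of, erule sndPs)
      then show ?thesis by (simp add: base_def del: upt_Suc)
    qed
    show "sorted (map (partial_sum base (seg_of Ps) (length us)) us)"
      using us(3) unfolding part by (simp cong: map_cong)
    show "inj_on (lsum 0 (arrangement base (seg_of Ps) f us)) S"
      using js(3) ctr by (simp cong: inj_on_cong)
    show "- int (card (parcs G `` {x})) < partial_sum base (seg_of Ps) (length us) u + int (length base) + 1"
      if ux: "u \<in> U" "x \<in> S" for u x
    proof -
      have "fst e \<noteq> u" if "e \<in> set bl" for e
      proof -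
        have "e \<in> out_arcs_S" using that unfolding bl(2) by (rule DiffD1)
        then have "fst e \<in> S" unfolding out_arcs_S_def by (cases e) simp
        then show ?thesis using ux(1) unfolding U_iff by metis
      qed
      then have "lsum (length lo) bl u \<ge> 0"
        by (rule lsum_nonneg_if_no_out)
      then have "lsum 0 base u \<ge> - int (length lo)"
        using lo(3)[of u] by (simp add: base_def lsum_append)
      then have "P u \<ge> - int (length lo) - int K"
        using K(1)[of u] unfolding P_def by linarith
      moreover have "int (length lo) \<le> int (length base)" by (simp add: base_def)
      moreover have "int K \<le> int (card (parcs G `` {x}))" using K(2)[OF ux(2)] by simp
      ultimately show ?thesis unfolding part by linarith
    qed
  qed
qed

end

section \<open>Separating the centres by moving cycles\<close>

lemma shift_append:
  "length js = length qs \<Longrightarrow> shift (qs @ qs') (js @ js') fs x = shift qs js fs x + shift qs' js' fs x"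
  by (simp add: shift_def)

lemma shift_zero: "(\<And>j. j \<in> set js \<Longrightarrow> count_list (take j fs) x = 0) \<Longrightarrow> shift qs js fs x = 0"
proof (induction js arbitrary: qs)
  case (Cons j js)
  show ?case
  proof (cases qs)
    case (Cons q qs')
    have "shift qs' js fs x = 0" using Cons.IH Cons.prems by simp
    then show ?thesis using Cons.prems[of j] Cons by (simp add: shift_def)
  qed (simp add: shift_def)
qed (simp add: shift_def)

lemma shift_take_cong:
  "(\<And>j. j \<in> set js \<Longrightarrow> take j fs = take j gs) \<Longrightarrow> shift qs js fs x = shift qs js gs x"
  unfolding shift_def
  by (intro arg_cong[where f = sum_list] map_cong) (auto dest: set_zip_rightD)

text \<open>If the position n is just past the first star arc of x, moving t cycles there changes the sum of x by
the total length of these cycles.\<close>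

lemma shift_replicate:
  "count_list (take n fs) x = 1 \<Longrightarrow> t \<le> length qs \<Longrightarrow>
     shift qs (replicate t n @ replicate (length qs - t) 0) fs x = int (sum_list (take t qs))"
proof (induction qs arbitrary: t)
  case (Cons q qs)
  show ?case
  proof (cases t)
    case 0
    have "shift (q # qs) (replicate (Suc (length qs)) 0) fs x = 0"
      by (rule shift_zero) auto
    then show ?thesis using 0 by simp
  next
    case (Suc t')
    then show ?thesis using Cons by (simp add: shift_def)
  qed
qed (simp add: shift_def)

text \<open>The sums of the initial parts of qs are strictly increasing and therefore more numerous than Z.\<close>

lemma avoid_by_prefix_sum:
  assumes "finite Z" "card Z \<le> length qs" "\<And>q. q \<in> set qs \<Longrightarrow> q \<ge> (1::nat)"
  shows "\<exists>t\<le>length qs. (c::int) + int (sum_list (take t qs)) \<notin> Z"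
proof (rule ccontr)
  assume *: "\<not> ?thesis"
  define g where "g t = c + int (sum_list (take t qs))" for t
  have "g s < g t" if "s < t" "t \<le> length qs" for s t
    using that
  proof (induction t)
    case (Suc t)
    have "qs ! t \<ge> 1" using Suc.prems assms(3) by simp
    then have "g t < g (Suc t)" using Suc.prems by (simp add: g_def take_Suc_conv_app_nth)
    then show ?case using Suc by (cases "s = t") auto
  qed simp
  then have "inj_on g {..length qs}"
    by (intro inj_onI) (metis atMost_iff less_irrefl nat_neq_iff)
  then have "card (g ` {..length qs}) = Suc (length qs)" by (simp add: card_image)
  moreover have "g ` {..length qs} \<subseteq> Z" using * by (auto simp: g_def)
  then have "card (g ` {..length qs}) \<le> card Z" using assms(1) by (rule card_mono[rotated])
  ultimately show False using assms(2) by simp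
qed

text \<open>Y contains the centres that are already finished; they do not occur in fs. Let y be the centre that is
the last to make its first appearance in fs. Moving some of the first card Y cycles just past the first
star arc of y takes y away from the values on Y. All further moves take place in front of that arc, so
that y can be added to Y.\<close>

lemma separate_extending:
  assumes "finite Y" "set fs \<inter> Y = {}" "inj_on c Y" "\<And>q. q \<in> set qs \<Longrightarrow> q \<ge> 1"
    "length qs \<ge> (\<Sum>i<card (set fs). card Y + i)"
  shows "\<exists>js. length js = length qs \<and> (\<forall>j\<in>set js. j \<le> length fs) \<and>
    inj_on (\<lambda>x. c x + shift qs js fs x) (set fs \<union> Y)"
  using assms
proof (induction "card (set fs)" arbitrary: fs Y c qs)
  case 0
  then have "fs = []" by simp
  moreover have "shift qs (replicate (length qs) 0) fs x = 0" for x
    by (rule shift_zero) auto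
  ultimately show ?case
    using "0.prems"(3) by (intro exI[of _ "replicate (length qs) 0"]) auto
next
  case (Suc k)
  \<comment> \<open>the shortest initial part that contains all centres ends with the first star arc of y\<close>
  define n where "n = (LEAST n. set (take n fs) = set fs)"
  have n: "set (take n fs) = set fs"
    unfolding n_def by (rule LeastI[of _ "length fs"]) simp
  have "set fs \<noteq> {}" using Suc.hyps(2) by auto
  have "n \<noteq> 0"
  proof
    assume "n = 0"
    then have "set fs = {}" using n by simp
    then show False using \<open>set fs \<noteq> {}\<close> by simp
  qed
  then obtain m where m: "n = Suc m" by (cases n) auto
  have "set (take m fs) \<noteq> set fs"
    using not_less_Least[of m "\<lambda>n. set (take n fs) = set fs"] m n_def by simp
  have "m < length fs"
  proof (rule ccontr)
    assume "\<not> m < length fs"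
    then have "set (take m fs) = set fs" by simp
    then show False using \<open>set (take m fs) \<noteq> set fs\<close> by simp
  qed
  define pre y where "pre = take m fs" and "y = fs ! m"
  have tk: "take n fs = pre @ [y]"
    using \<open>m < length fs\<close> by (simp add: m pre_def y_def take_Suc_conv_app_nth)
  have fs: "set fs = insert y (set pre)" using n tk by auto
  have y: "y \<notin> set pre" using \<open>set (take m fs) \<noteq> set fs\<close> fs by (auto simp: pre_def)
  have cpre: "card (set pre) = k" using Suc.hyps(2) fs y by simp
  define r where "r = card Y"
  have len: "length qs \<ge> r + (\<Sum>i<k. Suc r + i)"
    using Suc.prems(5) unfolding Suc.hyps(2)[symmetric] by (simp add: r_def sum.lessThan_Suc_shift del: sum.lessThan_Suc)
  define qs1 qs2 where "qs1 = take r qs" and "qs2 = drop r qs"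
  have qs: "qs = qs1 @ qs2" "length qs1 = r" "length qs2 \<ge> (\<Sum>i<k. Suc r + i)"
    using len by (auto simp: qs1_def qs2_def)
  have pos: "q \<ge> 1" if "q \<in> set qs1 \<union> set qs2" for q
    using Suc.prems(4) that qs(1) by simp
  have "card (c ` Y) \<le> length qs1" using Suc.prems(1) qs(2) r_def card_image_le by simp
  then obtain t where t: "t \<le> length qs1" "c y + int (sum_list (take t qs1)) \<notin> c ` Y"
    using avoid_by_prefix_sum[of "c ` Y" qs1 "c y"] Suc.prems(1) pos by auto
  define js1 where "js1 = replicate t n @ replicate (length qs1 - t) 0"
  have js1: "length js1 = length qs1" "\<And>j. j \<in> set js1 \<Longrightarrow> j \<le> length fs"
    using t(1) \<open>m < length fs\<close> m by (auto simp: js1_def)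
  define c' where "c' x = c x + shift qs1 js1 fs x" for x
  have yY: "y \<notin> Y" using Suc.prems(2) fs by auto
  have c'Y: "c' z = c z" if "z \<in> Y" for z
  proof -
    have "z \<notin> set fs" using that Suc.prems(2) by auto
    then have "count_list (take j fs) z = 0" for j
      using set_take_subset[of j fs] by (auto simp: count_list_0_iff)
    then show ?thesis by (simp add: c'_def shift_zero)
  qed
  have c'y: "c' y \<notin> c ` Y"
  proof -
    have "count_list (take n fs) y = 1" using y by (simp add: tk count_list_0_iff)
    then show ?thesis using t shift_replicate[of n fs y t qs1] by (simp add: c'_def js1_def)
  qed
  have "c' ` Y = c ` Y" using c'Y by (intro image_cong) auto
  moreover have "inj_on c' Y" using Suc.prems(3) inj_on_cong[of Y c' c, OF c'Y] by metis
  ultimately have "inj_on c' (insert y Y)"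
    using c'y unfolding inj_on_insert Diff_insert_absorb[OF yY] Diff_empty Diff_insert0[OF yY] by simp
  moreover have "set pre \<inter> insert y Y = {}" using Suc.prems(2) fs y by auto
  moreover have "card (insert y Y) = Suc r" using Suc.prems(1) yY by (simp add: r_def)
  ultimately obtain js2 where js2: "length js2 = length qs2" "\<And>j. j \<in> set js2 \<Longrightarrow> j \<le> length pre"
      "inj_on (\<lambda>x. c' x + shift qs2 js2 pre x) (set pre \<union> insert y Y)"
    using Suc.hyps(1)[OF cpre[symmetric], of "insert y Y" c' qs2] Suc.prems(1) pos qs(3) cpre by auto
  have "shift qs2 js2 pre x = shift qs2 js2 fs x" for x
  proof (rule shift_take_cong)
    fix j assume "j \<in> set js2"
    then have "j \<le> m" using js2(2) \<open>m < length fs\<close> by (simp add: pre_def)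
    then show "take j pre = take j fs" by (simp add: pre_def min_def)
  qed
  then have "c' x + shift qs2 js2 pre x = c x + shift qs (js1 @ js2) fs x" for x
    using js1(1) by (simp add: c'_def qs(1) shift_append)
  moreover have "set pre \<union> insert y Y = set fs \<union> Y" using fs by auto
  ultimately have "inj_on (\<lambda>x. c x + shift qs (js1 @ js2) fs x) (set fs \<union> Y)"
    using js2(3) by simp
  moreover have "j \<le> length fs" if "j \<in> set (js1 @ js2)" for j
    using that js1(2) js2(2) by (auto simp: pre_def intro: le_trans)
  moreover have "length (js1 @ js2) = length qs" using js1(1) js2(1) qs(1) by simp
  ultimately show ?case by blast
qed

theorem separating_many:
  assumes "\<And>q. q \<in> set qs \<Longrightarrow> q \<ge> 1" "length qs \<ge> \<Sum>{..<card S}"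
  shows "separating qs S"
  unfolding separating_def
  using separate_extending[of "{}" _ _ qs] assms by auto

lemma count_list_replicate: "count_list (replicate n a) x = (if x = a then n else 0)"
  by (induction n) auto

text \<open>The star arcs begin with p arcs of a centre a, followed by one of b; let d be the third centre. Moving a
cycle of length q past i \<le> p arcs adds i q to the sum of a, and moving it past p + 1 arcs adds p q to
the sum of a and q to the sum of b. These moves suffice, and the sum of d is never changed.\<close>

lemma separating_two:
  assumes "card S = 3" "q \<ge> 1" "q' \<ge> 1"
  shows "separating [q, q'] S"
  unfolding separating_def
proof (intro allI impI)
  fix fs :: "'a list" and c :: "'a \<Rightarrow> int"
  assume fs: "set fs = S"
  have finS: "finite S" using assms(1) by (auto intro: card_ge_0_finite)
  have "fs \<noteq> []" using fs assms(1) by auto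
  then obtain a gs where ags: "fs = a # gs" by (cases fs) auto
  define p where "p = length (takeWhile (\<lambda>x. x = a) fs)"
  have tw: "takeWhile (\<lambda>x. x = a) fs = replicate p a"
    unfolding p_def by (intro replicate_eqI) (auto dest: set_takeWhileD)
  have p1: "p \<ge> 1" by (simp add: p_def ags)
  have "dropWhile (\<lambda>x. x = a) fs \<noteq> []"
  proof
    assume "dropWhile (\<lambda>x. x = a) fs = []"
    then have "S \<subseteq> {a}" using fs by (auto simp: dropWhile_eq_Nil_conv)
    then have "card S \<le> 1" using card_mono[of "{a}" S] by simp
    then show False using assms(1) by simp
  qed
  then obtain b rest where br: "dropWhile (\<lambda>x. x = a) fs = b # rest"
    by (cases "dropWhile (\<lambda>x. x = a) fs") auto
  have ba: "b \<noteq> a" using hd_dropWhile[of "\<lambda>x. x = a" fs] br by simp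
  have fs': "fs = replicate p a @ b # rest"
    using takeWhile_dropWhile_id[of "\<lambda>x. x = a" fs] unfolding tw br by simp
  have "a \<in> S" "b \<in> S" using fs fs' ags by auto
  then have "card (S - {a, b}) = 1" using assms(1) ba finS by (subst card_Diff_subset) auto
  then obtain d where "S - {a, b} = {d}" by (rule card_1_singletonE)
  then have S: "S = {a, b, d}" "d \<noteq> a" "d \<noteq> b" using \<open>a \<in> S\<close> \<open>b \<in> S\<close> by auto
  define A where "A i = (if i \<le> p then i else p)" for i :: nat
  define B where "B i = (if i \<le> p then 0 else 1 :: nat)" for i :: nat
  have take1: "take i fs = replicate i a" if "i \<le> p" for i
    using that unfolding fs' by (simp add: min_def)
  have take2: "take (Suc p) fs = replicate p a @ [b]"
    unfolding fs' by simp
  have cnt: "count_list (take i fs) a = A i" "count_list (take i fs) b = B i" "count_list (take i fs) d = 0"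
    if "i \<le> Suc p" for i
    using that ba S(2,3) by (cases "i = Suc p"; simp add: take1 take2 count_list_replicate A_def B_def)+
  have sh: "shift [q, q'] [i, j] fs a = int q * int (A i) + int q' * int (A j)"
    "shift [q, q'] [i, j] fs b = int q * int (B i) + int q' * int (B j)"
    "shift [q, q'] [i, j] fs d = 0" if "i \<le> Suc p" "j \<le> Suc p" for i j
    using cnt[OF that(1)] cnt[OF that(2)] by (simp_all add: shift_def)
  define ok where "ok i j \<longleftrightarrow> i \<le> Suc p \<and> j \<le> Suc p \<and>
    c a + (int q * int (A i) + int q' * int (A j)) \<noteq> c b + (int q * int (B i) + int q' * int (B j)) \<and>
    c a + (int q * int (A i) + int q' * int (A j)) \<noteq> c d \<and>
    c b + (int q * int (B i) + int q' * int (B j)) \<noteq> c d" for i j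
  have vals: "A 0 = 0" "B 0 = 0" "A 1 = 1" "B 1 = 0" "A (Suc p) = p" "B (Suc p) = 1"
    "A (Suc 0) = 1" "B (Suc 0) = 0"
    using p1 by (auto simp: A_def B_def)
  \<comment> \<open>If the sums of b and d differ, that of a has to avoid two values and i, j \<le> 1 offer three. Otherwise b has to move,
    and the moves to p + 1 fail only if q = q' and the sum of a ends up at that of d.\<close>
  have "\<exists>i j. ok i j"
  proof (cases "c b = c d")
    case False
    have "ok 0 0 \<or> ok 1 0 \<or> ok 1 1"
      using False assms(2,3) p1 by (auto simp: ok_def vals)
    then show ?thesis by blast
  next
    case True
    show ?thesis
    proof (cases "ok (Suc p) 0 \<or> ok (Suc p) 1")
      case False
      then have "int q' = int q" "c a + int q * int p = c d"
        using True assms(2,3) p1 by (auto simp: ok_def vals)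
      note q = this
      show ?thesis
      proof (cases "p = 1")
        case p: True
        have "ok 2 2"
          using q True assms(2) vals(5,6) unfolding ok_def p by (simp add: numeral_2_eq_2)
        then show ?thesis by blast
      next
        case p: False
        then have "A 2 = 2" "B 2 = 0" "2 \<le> p" using p1 by (auto simp: A_def B_def)
        then have "ok (Suc p) 2"
          using q True assms(2) by (simp add: ok_def vals)
        then show ?thesis by blast
      qed
    qed blast
  qed
  then obtain i j where ij: "ok i j" by blast
  then have le: "i \<le> Suc p" "j \<le> Suc p" by (auto simp: ok_def)
  have "inj_on (\<lambda>x. c x + shift [q, q'] [i, j] fs x) S"
    using ij unfolding S(1) ok_def by (auto simp: inj_on_def sh[OF le])
  moreover have "Suc p \<le> length fs" by (simp add: fs')
  ultimately show "\<exists>js. length js = length [q, q'] \<and> (\<forall>j\<in>set js. j \<le> length fs) \<and>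
      inj_on (\<lambda>x. c x + shift [q, q'] js fs x) S"
    using le by (intro exI[of _ "[i, j]"]) auto
qed

section \<open>Sums at one, two or three centres\<close>

lemma sum_lsum_all_out:
  assumes "finite S" "\<And>e. e \<in> set es \<Longrightarrow> fst e \<in> S \<and> snd e \<notin> S"
  shows "(\<Sum>x\<in>S. lsum b es x) = - (\<Sum>i<length es. int (b + i + 1))"
proof -
  have "(\<Sum>i<length es. if fst (es ! i) \<in> S then int (b + i + 1) else 0) = (\<Sum>i<length es. int (b + i + 1))"
    using assms(2) by (intro sum.cong) auto
  then show ?thesis using sum_lsum[OF assms(1), of es b] assms(2) by simp
qed

lemma sum_lsum_none:
  assumes "\<And>e. e \<in> set es \<Longrightarrow> fst e \<notin> S \<and> snd e \<notin> S"
  shows "(\<Sum>x\<in>S. lsum b es x) = 0"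
  using assms by (intro sum.neutral ballI lsum_eq_0) metis

lemma two_sum_consecutive: "2 * (\<Sum>i<n. int (b + i + 1)) = 2 * int b * int n + int n * (int n + 1)"
  by (induction n) (auto simp: algebra_simps)

lemma lsum_single_out:
  assumes "distinct ws" "\<And>e. e \<in> set ws \<Longrightarrow> snd e \<noteq> x" "\<And>e. e \<in> set ws \<and> fst e = x \<longleftrightarrow> e = (x, w)"
  obtains i where "i < length ws" "ws ! i = (x, w)" "lsum 0 ws x = - int (i + 1)"
proof -
  have "(x, w) \<in> set ws" using assms(3)[of "(x, w)"] by simp
  then obtain i where i: "i < length ws" "ws ! i = (x, w)" by (metis in_set_conv_nth)
  have "incidence (ws ! j) x = (if j = i then - 1 else 0)" if j: "j < length ws" for j
  proof -
    have m: "ws ! j \<in> set ws" using j by simp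
    have "fst (ws ! j) = x \<longleftrightarrow> j = i"
      using assms(3)[of "ws ! j"] m i j assms(1) by (metis nth_eq_iff_index_eq)
    then show ?thesis using assms(2)[OF m] by (simp add: incidence_def)
  qed
  then have "lsum 0 ws x = (\<Sum>j<length ws. if j = i then - int (i + 1) else 0)"
    unfolding lsum_conv_sum by (intro sum.cong) auto
  also have "\<dots> = - int (i + 1)" using i(1) by (simp add: sum.delta')
  finally show ?thesis using that i by blast
qed

context star_graph
begin

lemma card_star_arcs: "card star_arcs = card U"
  unfolding star_arcs_def by (intro card_image) (auto simp: inj_on_def)

text \<open>In the plain arrangement the arcs leaving S have the labels b + 1, ..., b + n, where b is the number of
edges among the leaves. The total of the sums of the centres is therefore known exactly, whatever the
order of the star arcs is.\<close>

lemma plain_labelling: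
  obtains ws b n where "distinct ws" "set ws \<subseteq> L \<union> out_arcs_S" "out_arcs_S \<subseteq> set ws"
    "length ws = b + n" "n = card out_arcs_S" "L \<noteq> {} \<Longrightarrow> b > 0"
    "(\<Sum>x\<in>S. lsum 0 ws x) = - (\<Sum>i<n. int (b + i + 1))"
    "inj_on (lsum 0 ws) S \<Longrightarrow> \<exists>D \<tau>. antimagic_orientation G D \<tau>"
proof -
  obtain los bl us where p: "distinct us" "set us = U" "distinct los" "orients (set los) L"
    "distinct bl" "set bl = out_arcs_S - star_arcs"
    and conc: "inj_on (lsum 0 (los @ bl @ map (\<lambda>u. (f u, u)) us)) S \<Longrightarrow> \<exists>D \<tau>. antimagic_orientation G D \<tau>"
    by (rule plain_arrangement) blast
  define X where "X = bl @ map (\<lambda>u. (f u, u)) us"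
  have stars: "set (map (\<lambda>u. (f u, u)) us) = star_arcs" using p(2) by (simp add: star_arcs_def)
  have setX: "set X = out_arcs_S" unfolding X_def set_append p(6) stars using star_subset by auto
  have distX: "distinct X"
    unfolding X_def using p(1,5) p(6) stars by (auto simp: distinct_map inj_on_def)
  have los: "set los \<subseteq> L" using p(4) by (auto simp: orients_def)
  have "L \<inter> out_arcs_S = {}" by (auto simp: L_def out_arcs_S_def U_iff)
  then have dist: "distinct (los @ X)" using p(3) distX setX los by auto
  have "(\<Sum>x\<in>S. lsum 0 los x) = 0"
    using los by (intro sum_lsum_none) (auto simp: L_def U_iff)
  moreover have "(\<Sum>x\<in>S. lsum (length los) X x) = - (\<Sum>i<length X. int (length los + i + 1))"
    using finS setX by (intro sum_lsum_all_out) (auto simp: out_arcs_S_def U_iff)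
  ultimately have "(\<Sum>x\<in>S. lsum 0 (los @ X) x) = - (\<Sum>i<length X. int (length los + i + 1))"
    by (simp add: lsum_append sum.distrib)
  moreover have "length X = card out_arcs_S" using distinct_card[OF distX] setX by simp
  moreover have "length los > 0" if "L \<noteq> {}" using that p(4) by (auto simp: orients_def)
  ultimately show ?thesis
    using that[of "los @ X" "length los" "length X"] dist los setX conc unfolding X_def by auto
qed

lemma single_out_arc:
  assumes "distinct ws" "set ws \<subseteq> L \<union> out_arcs_S" "out_arcs_S \<subseteq> set ws" "x \<in> S" "parcs G `` {x} = {w}"
  obtains i where "i < length ws" "ws ! i = (x, w)" "lsum 0 ws x = - int (i + 1)"
proof (rule lsum_single_out[OF assms(1)])
  show "snd e \<noteq> x" if "e \<in> set ws" for e
    using that assms(2,4) by (auto simp: L_def out_arcs_S_def U_iff)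
  show "e \<in> set ws \<and> fst e = x \<longleftrightarrow> e = (x, w)" for e
  proof -
    have "(x, u) \<in> out_arcs_S \<longleftrightarrow> u = w" for u
      using assms(5) out_arcs_of[OF assms(4)] by auto
    moreover have "(x, u) \<notin> L" for u using assms(4) by (auto simp: L_def U_iff)
    ultimately show ?thesis using assms(2,3) by (cases e) auto
  qed
qed

lemma antimagic_one_centre:
  assumes "S = {x}"
  shows "\<exists>D \<tau>. antimagic_orientation G D \<tau>"
  by (rule plain_labelling) (use assms in simp)

text \<open>A centre of degree one has as its sum minus a single label. If the other centre had the same sum, then
twice this label would be the total of all labels b + 1, ..., b + n, where b > 0. That is impossible: by parity for
n = 2, and because the total is too large for n \<ge> 3.\<close>

lemma antimagic_two_centres_pendant:
  assumes "S = {x, y}" "x \<noteq> y" "card (parcs G `` {x}) = 1" "parcs G `` {y} \<noteq> {}" "L \<noteq> {}"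
  shows "\<exists>D \<tau>. antimagic_orientation G D \<tau>"
proof -
  obtain ws b n where ws: "distinct ws" "set ws \<subseteq> L \<union> out_arcs_S" "out_arcs_S \<subseteq> set ws"
    "length ws = b + n" "n = card out_arcs_S" "L \<noteq> {} \<Longrightarrow> b > 0"
    and tot: "(\<Sum>x\<in>S. lsum 0 ws x) = - (\<Sum>i<n. int (b + i + 1))"
    and conc: "inj_on (lsum 0 ws) S \<Longrightarrow> \<exists>D \<tau>. antimagic_orientation G D \<tau>"
    by (rule plain_labelling) blast
  obtain w where w: "parcs G `` {x} = {w}" using assms(3) by (rule card_1_singletonE)
  obtain i where i: "i < length ws" "lsum 0 ws x = - int (i + 1)"
    using single_out_arc[OF ws(1-3) _ w] assms(1) by blast
  have "n \<ge> 2"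
  proof -
    obtain v where v: "(y, v) \<in> parcs G" using assms(4) by auto
    have "{(x, w), (y, v)} \<subseteq> out_arcs_S"
      using w v out_arcs_of[of x] out_arcs_of[of y] assms(1) by auto
    then have "card {(x, w), (y, v)} \<le> n"
      unfolding ws(5) by (intro card_mono fin_out_arcs_S)
    then show ?thesis using assms(2) by simp
  qed
  have "lsum 0 ws x \<noteq> lsum 0 ws y"
  proof
    assume eq: "lsum 0 ws x = lsum 0 ws y"
    have "lsum 0 ws x + lsum 0 ws y = - (\<Sum>i<n. int (b + i + 1))"
      using tot assms(1,2) by simp
    then have "4 * int i + 4 = 2 * (\<Sum>i<n. int (b + i + 1))" using eq i(2) by simp
    then have T: "4 * int i + 4 = 2 * int b * int n + int n * (int n + 1)"
      unfolding two_sum_consecutive .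
    have le: "int i + 1 \<le> int b + int n" using i(1) ws(4) by simp
    have "int b \<ge> 1" using ws(6)[OF assms(5)] by simp
    consider "n = 2" | "n = 3" | "n \<ge> 4" using \<open>n \<ge> 2\<close> by linarith
    then show False
    proof cases
      case 1
      \<comment> \<open>the two sides differ modulo 4\<close>
      then have "4 * int i + 4 = 4 * int b + 6" using T by simp
      then show False by presburger
    next
      case 2
      then have "4 * int i + 4 = 6 * int b + 12" using T by simp
      then show False using le 2 \<open>int b \<ge> 1\<close> by simp
    next
      case 3
      have "int b * 4 \<le> int b * int n" using 3 by (intro mult_left_mono) auto
      then have "int b * 8 \<le> 2 * int b * int n" by linarith
      moreover have "int n * 5 \<le> int n * (int n + 1)" using 3 by (intro mult_left_mono) auto
      ultimately have "4 * int i + 4 \<ge> 8 * int b + 5 * int n" using T by linarith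
      moreover have "int n \<ge> 4" using 3 by simp
      ultimately show False using le \<open>int b \<ge> 1\<close> by linarith
    qed
  qed
  then show ?thesis using conc assms(1,2) by auto
qed

text \<open>Two pendant centres with a common neighbour cannot both have a star arc, so that shifting cycles does
not help. But their sums are minus two distinct single labels, and at least nine labels remain for the
third centre.\<close>

lemma antimagic_twin_pendants:
  assumes "S = {x, y, z}" "card S = 3" "parcs G `` {x} = {u}" "parcs G `` {y} = {u}" "card U \<ge> 10"
  shows "\<exists>D \<tau>. antimagic_orientation G D \<tau>"
proof -
  have ne: "x \<noteq> y" "x \<noteq> z" "y \<noteq> z" using assms(1,2) by (auto simp: card_insert_if split: if_splits)
  obtain ws b n where ws: "distinct ws" "set ws \<subseteq> L \<union> out_arcs_S" "out_arcs_S \<subseteq> set ws"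
    "length ws = b + n" "n = card out_arcs_S" "L \<noteq> {} \<Longrightarrow> b > 0"
    and tot: "(\<Sum>x\<in>S. lsum 0 ws x) = - (\<Sum>i<n. int (b + i + 1))"
    and conc: "inj_on (lsum 0 ws) S \<Longrightarrow> \<exists>D \<tau>. antimagic_orientation G D \<tau>"
    by (rule plain_labelling) blast
  have xS: "x \<in> S" and yS: "y \<in> S" using assms(1) by auto
  obtain i where i: "i < length ws" "ws ! i = (x, u)" "lsum 0 ws x = - int (i + 1)"
    using single_out_arc[OF ws(1-3) xS assms(3)] .
  obtain j where j: "j < length ws" "ws ! j = (y, u)" "lsum 0 ws y = - int (j + 1)"
    using single_out_arc[OF ws(1-3) yS assms(4)] .
  have "i \<noteq> j" using i(2) j(2) ne(1) by auto
  have n: "n \<ge> 11"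
  proof -
    have "{(x, u), (y, u)} \<subseteq> out_arcs_S"
      using out_arcs_of[OF xS] out_arcs_of[OF yS] assms(3,4) by auto
    moreover have "\<not> {(x, u), (y, u)} \<subseteq> star_arcs" using ne(1) by (auto simp: star_arcs_def)
    ultimately have "star_arcs \<subset> out_arcs_S" using star_subset by auto
    then have "card star_arcs < n" unfolding ws(5) by (intro psubset_card_mono fin_out_arcs_S)
    then show ?thesis using assms(5) by (simp add: card_star_arcs)
  qed
  have "lsum 0 ws x + lsum 0 ws y + lsum 0 ws z = - (\<Sum>i<n. int (b + i + 1))"
    using tot assms(1) ne by (simp add: algebra_simps)
  moreover define P Q where "P = 2 * int b * int n" and "Q = int n * (int n + 1)"
  ultimately have eq: "2 * int i + 2 * int j + 4 - 2 * lsum 0 ws z = P + Q"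
    unfolding P_def Q_def two_sum_consecutive[symmetric] using i(3) j(3) by simp
  have "int b * 11 \<le> int b * int n" using n by (intro mult_left_mono) auto
  then have bn: "int b * 22 \<le> P" unfolding P_def by linarith
  have nn: "int n * 12 \<le> Q" unfolding Q_def using n by (intro mult_left_mono) auto
  have ij: "int i + 1 \<le> int b + int n" "int j + 1 \<le> int b + int n" using i(1) j(1) ws(4) by simp_all
  have nb: "int n > 0" "int b \<ge> 0" using n by simp_all
  have "lsum 0 ws z < - int i - 1" using eq bn nn ij nb by linarith
  moreover have "lsum 0 ws z < - int j - 1" using eq bn nn ij nb by linarith
  ultimately have "lsum 0 ws z < - int (i + 1)" "lsum 0 ws z < - int (j + 1)" by simp_all
  then have "inj_on (lsum 0 ws) S"
    unfolding assms(1) using i(3) j(3) \<open>i \<noteq> j\<close> by auto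
  then show ?thesis by (rule conc)
qed

text \<open>If y is adjacent to all leaves, all star arcs can start in y. Then x has at most as many arcs as y, and
all of them have lower labels.\<close>

lemma antimagic_dominating_centre:
  assumes "S = {x, y}" "x \<noteq> y" "\<And>u. u \<in> U \<Longrightarrow> f u = y" "U \<noteq> {}"
  shows "\<exists>D \<tau>. antimagic_orientation G D \<tau>"
proof -
  obtain los bl us where p: "distinct us" "set us = U" "distinct los" "orients (set los) L"
    "distinct bl" "set bl = out_arcs_S - star_arcs"
    and conc: "inj_on (lsum 0 (los @ bl @ map (\<lambda>u. (f u, u)) us)) S \<Longrightarrow> \<exists>D \<tau>. antimagic_orientation G D \<tau>"
    by (rule plain_arrangement) blast
  define st where "st = map (\<lambda>u. (f u, u)) us"
  define b d N where "b = length los" and "d = length bl" and "N = length st"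
  have xyU: "x \<notin> U" "y \<notin> U" using assms(1) by (auto simp: U_iff)
  have bl: "fst e = x \<and> snd e \<in> U" if "e \<in> set bl" for e
  proof -
    have e: "e \<in> out_arcs_S" "e \<notin> star_arcs" using that unfolding p(6) by blast+
    then have e': "fst e \<in> S" "snd e \<in> U" by (auto simp: out_arcs_S_def)
    have "fst e \<noteq> y"
    proof
      assume "fst e = y"
      then have "e = (f (snd e), snd e)" using assms(3)[OF e'(2)] by (simp add: prod_eq_iff)
      then show False using e(2) e'(2) unfolding star_arcs_def by blast
    qed
    then show ?thesis using e' assms(1) by blast
  qed
  have st: "fst e = y \<and> snd e \<in> U" if "e \<in> set st" for e
    using that p(2) assms(3) by (auto simp: st_def)
  have "set los \<subseteq> L" using p(4) by (auto simp: orients_def)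
  then have los: "fst e \<in> U \<and> snd e \<in> U" if "e \<in> set los" for e
    using that unfolding L_def by auto
  have one: "lsum c es v = - (\<Sum>i<length es. int (c + i + 1))"
    if "\<And>e. e \<in> set es \<Longrightarrow> fst e = v \<and> snd e \<noteq> v" for c es and v :: 'a
    using sum_lsum_all_out[of "{v}" es c] that by simp
  have los0: "lsum 0 los v = 0" if "v \<notin> U" for v
    by (rule lsum_eq_0) (use los that in blast)
  have "lsum b bl x = - (\<Sum>i<d. int (b + i + 1))"
    unfolding d_def by (rule one) (use bl xyU in blast)
  moreover have "lsum (b + d) st x = 0"
    by (rule lsum_eq_0) (use st xyU assms(2) in blast)
  ultimately have x: "lsum 0 (los @ bl @ st) x = - (\<Sum>i<d. int (b + i + 1))"
    by (simp add: lsum_append los0 xyU b_def d_def)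
  have "lsum b bl y = 0"
    by (rule lsum_eq_0) (use bl xyU assms(2) in blast)
  moreover have "lsum (b + d) st y = - (\<Sum>i<N. int (b + d + i + 1))"
    unfolding N_def by (rule one) (use st xyU in blast)
  ultimately have y: "lsum 0 (los @ bl @ st) y = - (\<Sum>i<N. int (b + d + i + 1))"
    by (simp add: lsum_append los0 xyU b_def d_def)
  have N: "N = card U" using distinct_card[OF p(1)] p(2) by (simp add: N_def st_def)
  then have "N \<ge> 1" using assms(4) finU by (simp add: Suc_le_eq card_gt_0_iff)
  have Nne: "{..<N} \<noteq> {}"
  proof -
    have "0 \<in> {..<N}" using \<open>N \<ge> 1\<close> by simp
    then show ?thesis by blast
  qed
  have "set bl \<subseteq> Pair x ` U" using bl by force
  then have "card (set bl) \<le> card (Pair x ` U)" using finU by (intro card_mono) auto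
  also have "\<dots> \<le> N" unfolding N by (rule card_image_le[OF finU])
  finally have "d \<le> N" using distinct_card[OF p(5)] by (simp add: d_def)
  have "(\<Sum>i<d. int (b + i + 1)) < (\<Sum>i<N. int (b + d + i + 1))"
  proof (cases "d = 0")
    case True
    have "0 < (\<Sum>i<N. int (b + d + i + 1))"
      using Nne by (intro sum_pos) simp_all
    then show ?thesis using True by simp
  next
    case False
    have "(\<Sum>i<d. int (b + i + 1)) \<le> (\<Sum>i<N. int (b + i + 1))"
      using \<open>d \<le> N\<close> by (intro sum_mono2) auto
    also have "\<dots> < (\<Sum>i<N. int (b + d + i + 1))"
      using Nne False by (intro sum_strict_mono) simp_all
    finally show ?thesis .
  qed
  then have "lsum 0 (los @ bl @ st) x \<noteq> lsum 0 (los @ bl @ st) y" unfolding x y by simp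
  then show ?thesis using conc assms(1,2) unfolding st_def by auto
qed

end

section \<open>Two centres by parity\<close>

text \<open>The parity argument uses segments only directly below and directly above the lowest star arc.\<close>

lemma weave_short:
  assumes "n \<ge> 1" "\<And>i. i \<ge> 2 \<Longrightarrow> seg i = []"
  shows "weave seg star n @ seg n = seg 0 @ [star 0] @ seg 1 @ map star [1..<n]"
  using assms(1)
proof (induction n rule: nat_induct_at_least)
  case base
  then show ?case by simp
next
  case (Suc n)
  have "seg (Suc n) = []" using Suc.hyps by (intro assms(2)) simp
  then have "weave seg star (Suc n) @ seg (Suc n) = (weave seg star n @ seg n) @ [star n]" by simp
  also have "\<dots> = seg 0 @ [star 0] @ seg 1 @ map star [1..<n] @ [star n]"
    unfolding Suc.IH by simp
  also have "map star [1..<n] @ [star n] = map star [1..<Suc n]"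
    using Suc.hyps by simp
  finally show ?case .
qed

lemma concat_short:
  assumes "n \<ge> 2" "\<And>i. i \<ge> 2 \<Longrightarrow> seg i = []"
  shows "concat (map seg [0..<n]) = seg 0 @ seg 1"
  using assms(1)
proof (induction n rule: nat_induct_at_least)
  case base
  have "[0..<2] = [0, 1]" by (simp add: upt_rec)
  then show ?case by simp
next
  case (Suc n)
  have "concat (map seg [0..<Suc n]) = concat (map seg [0..<n]) @ seg n" by simp
  then show ?case using Suc.IH assms(2)[OF Suc.hyps] by simp
qed

lemma partial_sum_short:
  assumes "n \<ge> 1" "\<And>i. i \<ge> 2 \<Longrightarrow> seg i = []"
  shows "partial_sum base seg n v = lsum 0 base v + lsum (length base) (seg 0) v +
    lsum (length base + 1 + length (seg 0)) (seg 1) v"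
proof -
  have z: "lsum c (seg i) v = 0" if "i \<ge> 2" for c i using assms(2)[OF that] by simp
  have "(\<Sum>i\<le>n. lsum (length base + seg_start seg i) (seg i) v) =
      (\<Sum>i\<in>{0,1}. lsum (length base + seg_start seg i) (seg i) v)"
  proof (rule sum.mono_neutral_right)
    show "{0, 1} \<subseteq> {..n}" using assms(1) by auto
    show "\<forall>i\<in>{..n} - {0, 1}. lsum (length base + seg_start seg i) (seg i) v = 0"
    proof
      fix i assume "i \<in> {..n} - {0, 1}"
      then have "i \<ge> 2" by (cases i) auto
      then show "lsum (length base + seg_start seg i) (seg i) v = 0" by (rule z)
    qed
  qed simp
  also have "\<dots> = lsum (length base) (seg 0) v + lsum (length base + 1 + length (seg 0)) (seg 1) v"
    by (simp add: seg_start_def)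
  finally show ?thesis by (simp add: partial_sum_def)
qed

context star_graph
begin

text \<open>Let e be the edge among the leaves with the highest label. Exchanging e with the lowest star arc changes
the total of the labels at the centres by one, so in one of the two arrangements the total is odd and
the sums of the two centres differ. The exchange lowers the bound for the sums of the leaves by two,
which is harmless if both centres have degree at least two.\<close>

lemma antimagic_two_centres_parity:
  assumes S: "S = {x, y}" "x \<noteq> y" and deg: "\<And>z. z \<in> S \<Longrightarrow> card (parcs G `` {z}) \<ge> 2" and L: "L \<noteq> {}"
  shows "\<exists>D \<tau>. antimagic_orientation G D \<tau>"
proof -
  obtain los where los: "distinct los" "orients (set los) L" "\<And>v. lsum 0 los v \<ge> - int (length los)"
    using low_labelling[OF finL symL irreflL] by blast
  have losL: "set los \<subseteq> L" using los(2) by (auto simp: orients_def)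
  have "los \<noteq> []" using los(2) L by (auto simp: orients_def)
  then obtain lo e where lo: "los = lo @ [e]" by (cases los rule: rev_cases) auto
  obtain bl where bl: "distinct bl" "set bl = out_arcs_S - star_arcs"
    using finite_distinct_list[of "out_arcs_S - star_arcs"] fin_out_arcs_S by auto
  define M N R where "M = length lo" and "N = card U" and "R = length bl + (N - 1)"
  define t where "t = (\<Sum>i<R. int (M + 2 + i + 1))"
  \<comment> \<open>\<open>\<delta>\<close> means that e stays below the lowest star arc; t is the total of the labels above both\<close>
  define \<delta> where "\<delta> \<longleftrightarrow> odd (int (M + 2) + t)"
  define seg where "seg i = (if i = 0 then if \<delta> then [e] else []
      else if i = 1 then if \<delta> then bl else e # bl else [])" for i :: nat
  have seg: "seg 0 = (if \<delta> then [e] else [])" "seg 1 = (if \<delta> then bl else e # bl)"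
    "\<And>i. i \<ge> 2 \<Longrightarrow> seg i = []" unfolding seg_def by simp_all
  have eL: "e \<in> L" using losL lo by simp
  then have eU: "fst e \<in> U" "snd e \<in> U" by (auto simp: L_def)
  have "N \<noteq> 0" using eU(1) finU by (auto simp: N_def)
  then have N: "N \<ge> 1" by simp
  obtain us where us: "distinct us" "set us = U" "sorted (map (partial_sum lo seg N) us)"
    using ex_sorted_leaves by blast
  have lenus: "length us = N" using distinct_card[OF us(1)] us(2) by (simp add: N_def)
  define star where "star i = (f (us ! i), us ! i)" for i
  define rest where "rest = bl @ map star [1..<N]"
  define ws where "ws = arrangement lo seg f us"
  have ws: "ws = lo @ seg 0 @ [star 0] @ seg 1 @ map star [1..<N]"
    using weave_short[of N seg star] N seg(3) unfolding ws_def arrangement_def lenus star_def by simp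
  have star: "fst (star i) \<in> S \<and> snd (star i) \<in> U" if "i < N" for i
  proof -
    have "us ! i \<in> U" using that lenus us(2) nth_mem by blast
    then show ?thesis using f(1) by (simp add: star_def)
  qed
  have rest: "fst g \<in> S \<and> snd g \<notin> S" if g: "g \<in> set rest" for g
  proof (cases "g \<in> set bl")
    case True
    then have "g \<in> out_arcs_S" unfolding bl(2) by blast
    then show ?thesis by (auto simp: out_arcs_S_def U_iff)
  next
    case False
    then obtain i where "i < N" "g = star i" using g by (auto simp: rest_def)
    then show ?thesis using star[of i] by (simp add: U_iff)
  qed
  have lenrest: "length rest = R" by (simp add: rest_def R_def)
  have out: "(\<Sum>z\<in>S. lsum c rest z) = - (\<Sum>i<R. int (c + i + 1))" for c
    unfolding lenrest[symmetric] using rest by (rule sum_lsum_all_out[OF finS])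
  have star0: "(\<Sum>z\<in>S. lsum c [star 0] z) = - int (c + 1)" for c
    using sum_lsum_all_out[OF finS, of "[star 0]" c] star[of 0] N by (simp add: U_iff)
  have none: "(\<Sum>z\<in>S. lsum c xs z) = 0" if "set xs \<subseteq> L" for c xs
    using that by (intro sum_lsum_none) (auto simp: L_def U_iff)
  have lo0: "(\<Sum>z\<in>S. lsum 0 lo z) = 0" using losL lo by (intro none) auto
  have e0: "(\<Sum>z\<in>S. lsum c [e] z) = 0" for c using eL by (intro none) simp
  have split: "(\<Sum>z\<in>S. lsum 0 (lo @ [a] @ [b] @ rest) z) = (\<Sum>z\<in>S. lsum 0 lo z) +
      (\<Sum>z\<in>S. lsum M [a] z) + (\<Sum>z\<in>S. lsum (M + 1) [b] z) + (\<Sum>z\<in>S. lsum (M + 2) rest z)" for a b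
    unfolding lsum_append sum.distrib by (simp add: M_def del: lsum.simps)
  have "odd (\<Sum>z\<in>S. lsum 0 ws z)"
  proof (cases \<delta>)
    case True
    have "ws = lo @ [e] @ [star 0] @ rest" using True unfolding ws seg rest_def by simp
    then have "(\<Sum>z\<in>S. lsum 0 ws z) = (\<Sum>z\<in>S. lsum 0 lo z) + (\<Sum>z\<in>S. lsum M [e] z) +
        (\<Sum>z\<in>S. lsum (M + 1) [star 0] z) + (\<Sum>z\<in>S. lsum (M + 2) rest z)"
      by (simp only: split)
    also have "\<dots> = - (int (M + 2) + t)"
      unfolding lo0 e0 star0 out t_def by simp
    finally have eq: "(\<Sum>z\<in>S. lsum 0 ws z) = - (int (M + 2) + t)" .
    show ?thesis using True unfolding eq \<delta>_def even_minus .
  next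
    case False
    have "ws = lo @ [star 0] @ [e] @ rest" using False unfolding ws seg rest_def by simp
    then have "(\<Sum>z\<in>S. lsum 0 ws z) = (\<Sum>z\<in>S. lsum 0 lo z) + (\<Sum>z\<in>S. lsum M [star 0] z) +
        (\<Sum>z\<in>S. lsum (M + 1) [e] z) + (\<Sum>z\<in>S. lsum (M + 2) rest z)"
      by (simp only: split)
    also have "\<dots> = 1 - (int (M + 2) + t)"
      unfolding lo0 e0 star0 out t_def by simp
    finally have eq: "(\<Sum>z\<in>S. lsum 0 ws z) = 1 - (int (M + 2) + t)" .
    have "odd (1 - X)" if "\<not> odd X" for X :: int using that by simp
    then show ?thesis using False unfolding eq \<delta>_def by blast
  qed
  moreover have "(\<Sum>z\<in>S. lsum 0 ws z) = lsum 0 ws x + lsum 0 ws y"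
    using S by simp
  ultimately have "lsum 0 ws x \<noteq> lsum 0 ws y" by auto
  then have inj: "inj_on (lsum 0 ws) S" using S by auto
  have part: "partial_sum lo seg N u \<ge> - int M - 2" if "u \<in> U" for u
  proof -
    have "fst g \<noteq> u" if "g \<in> set bl" for g
    proof -
      have "g \<in> out_arcs_S" using that unfolding bl(2) by (rule DiffD1)
      then have "fst g \<in> S" unfolding out_arcs_S_def by (cases g) simp
      then show ?thesis using \<open>u \<in> U\<close> unfolding U_iff by metis
    qed
    then have b: "lsum c bl u \<ge> 0" for c
      by (rule lsum_nonneg_if_no_out)
    have l: "lsum 0 lo u + int (M + 1) * incidence e u \<ge> - int M - 1"
      using los(3)[of u] by (simp add: lo lsum_append M_def)
    have i: "incidence e u \<ge> - 1" by (simp add: incidence_def)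
    have p: "partial_sum lo seg N u = lsum 0 lo u + lsum M (seg 0) u + lsum (M + 1 + length (seg 0)) (seg 1) u"
      using partial_sum_short[OF N seg(3)] by (simp add: M_def)
    show ?thesis
    proof (cases \<delta>)
      case True
      then have "partial_sum lo seg N u = (lsum 0 lo u + int (M + 1) * incidence e u) + lsum (M + 2) bl u"
        unfolding p seg by simp
      then show ?thesis using b[of "M + 2"] l by linarith
    next
      case False
      then have "partial_sum lo seg N u =
          (lsum 0 lo u + int (M + 1) * incidence e u) + incidence e u + lsum (M + 2) bl u"
        unfolding p seg by (simp add: algebra_simps)
      then show ?thesis using b[of "M + 2"] l i by linarith
    qed
  qed
  show ?thesis
  proof (rule antimagic_if_arranged[where base = lo and seg = seg, OF us(1,2) _ los(1,2) bl])
    show "mset (lo @ concat (map seg [0..<Suc (length us)])) = mset (los @ bl)"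
      using concat_short[of "Suc N" seg] N seg unfolding lenus lo by (simp del: upt_Suc)
    show "sorted (map (partial_sum lo seg (length us)) us)" using us(3) by (simp only: lenus)
    show "inj_on (lsum 0 (arrangement lo seg f us)) S" using inj by (simp only: ws_def)
    show "- int (card (parcs G `` {z})) < partial_sum lo seg (length us) u + int (length lo) + 1"
      if "u \<in> U" "z \<in> S" for u z
    proof -
      have "int (card (parcs G `` {z})) \<ge> 2" using deg[OF that(2)] by simp
      then show ?thesis using part[OF that(1)] unfolding lenus M_def by linarith
    qed
  qed
qed

end

section \<open>Connectedness and independent sets\<close>

lemma connected_cut:
  assumes G: "pair_graph G" "Digraph_Component.connected (with_proj G)"
    and X: "X \<subseteq> pverts G" "X \<noteq> {}" "X \<noteq> pverts G"
  shows "\<exists>a b. (a, b) \<in> parcs G \<and> a \<in> X \<and> b \<notin> X"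
proof (rule ccontr)
  assume no: "\<not> ?thesis"
  define H where "H = with_proj (mk_symmetric (with_proj G))"
  have arcs: "arcs_ends H = parcs (mk_symmetric (with_proj G))" by (simp add: H_def)
  have closed: "b \<in> X" if ab: "(a, b) \<in> arcs_ends H" "a \<in> X" for a b
  proof -
    have "(a, b) \<in> parcs G \<or> (b, a) \<in> parcs G"
      using ab(1) unfolding arcs parcs_mk_symmetric by auto
    then have "(a, b) \<in> parcs G" using pair_graph_sym[OF G(1)] by blast
    then show ?thesis using no ab(2) by blast
  qed
  obtain u where u: "u \<in> X" using X(2) by auto
  have "pverts G \<subseteq> X"
  proof
    fix v assume "v \<in> pverts G"
    moreover have "u \<in> pverts G" using u X(1) by auto
    ultimately have "u \<rightarrow>\<^sup>*\<^bsub>H\<^esub> v"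
      using G(2) by (simp add: Digraph_Component.connected_def strongly_connected_def H_def)
    then have "(u, v) \<in> rtrancl_on (verts H) (arcs_ends H)"
      by (simp add: reachable_def)
    then show "v \<in> X"
      using u
    proof (induction rule: rtrancl_on.induct)
      case (rtrancl_on_into_rtrancl_on a b c)
      then show ?case using closed by blast
    qed simp
  qed
  then show False using X by auto
qed

lemma ex_maximum_independent_set:
  assumes "pair_graph G"
  obtains S where "independent_set G S" "card S = independence_number G"
    "\<And>X. independent_set G X \<Longrightarrow> card X \<le> independence_number G"
proof -
  let ?A = "{card S |S. independent_set G S}"
  have "?A \<subseteq> card ` Pow (pverts G)" by (auto simp: independent_set_def)
  moreover have "finite (card ` Pow (pverts G))" using pair_graph_finite[OF assms] by simp
  ultimately have fin: "finite ?A" by (rule finite_subset)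
  have "independent_set G {}" by (simp add: independent_set_def)
  then have ne: "?A \<noteq> {}" by blast
  have "Max ?A \<in> ?A" using fin ne by (rule Max_in)
  then obtain S where "independent_set G S" "card S = Max ?A" by auto
  moreover have "card X \<le> Max ?A" if "independent_set G X" for X
    using that by (intro Max_ge[OF fin]) auto
  ultimately show ?thesis using that unfolding independence_number_def by auto
qed

lemma maximum_independent_dominating:
  assumes "pair_graph G" "independent_set G S" "\<And>X. independent_set G X \<Longrightarrow> card X \<le> card S"
    and u: "u \<in> pverts G - S"
  shows "\<exists>x\<in>S. (x, u) \<in> parcs G"
proof (rule ccontr)
  assume no: "\<not> ?thesis"
  have "(u, x) \<notin> parcs G" if "x \<in> S" for x
    using no that pair_graph_sym[OF assms(1)] by blast
  then have "independent_set G (insert u S)"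
    using assms(2) u no by (auto simp: independent_set_def pairwise_insert)
  then have "card (insert u S) \<le> card S" by (rule assms(3))
  moreover have "finite S"
    using assms(2) pair_graph_finite[OF assms(1)] by (auto simp: independent_set_def intro: finite_subset)
  ultimately show False using u by simp
qed

text \<open>Each set is larger than the number of elements chosen for the other sets, so the choice can be greedy.\<close>

lemma system_of_representatives:
  assumes "finite S" "\<And>x. x \<in> S \<Longrightarrow> finite (P x) \<and> card (P x) \<ge> card S"
  shows "\<exists>g. inj_on g S \<and> (\<forall>x\<in>S. g x \<in> P x)"
  using assms
proof (induction S rule: finite_induct)
  case (insert x S)
  have "finite (P z) \<and> card (P z) \<ge> card S" if "z \<in> S" for z
    using insert.prems[of z] that insert.hyps by simp
  then obtain g where g: "inj_on g S" "\<forall>z\<in>S. g z \<in> P z" using insert.IH by blast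
  have "card (g ` S) < card (P x)"
    using insert.prems[of x] insert.hyps card_image_le[of S g] by simp
  then have "\<not> P x \<subseteq> g ` S" using card_mono[of "g ` S" "P x"] insert.hyps by auto
  then obtain w where w: "w \<in> P x" "w \<notin> g ` S" by blast
  have eq: "(g(x := w)) z = g z" if "z \<in> S" for z using that insert.hyps by auto
  have "inj_on (g(x := w)) (insert x S)"
    using g(1) w(2) insert.hyps by (auto simp: inj_on_def)
  moreover have "\<forall>z\<in>insert x S. (g(x := w)) z \<in> P z"
    using g(2) w(1) eq by auto
  ultimately show ?case by blast
qed simp

text \<open>Distinct representatives ensure that every centre has a star arc, as \<open>separating\<close> requires.\<close>

lemma star_graph_of_representatives:
  assumes "pair_graph G" "independent_set G S" "\<And>u. u \<in> pverts G - S \<Longrightarrow> \<exists>x\<in>S. (x, u) \<in> parcs G"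
    and g: "inj_on g S" "\<And>x. x \<in> S \<Longrightarrow> (x, g x) \<in> parcs G"
  obtains f where "star_graph G S (pverts G - S) f" "f ` (pverts G - S) = S"
proof -
  define f where "f u = (if u \<in> g ` S then the_inv_into S g u else SOME x. x \<in> S \<and> (x, u) \<in> parcs G)" for u
  have fg: "f (g x) = x" if "x \<in> S" for x
    using that g(1) by (simp add: f_def the_inv_into_f_f)
  have f: "f u \<in> S \<and> (f u, u) \<in> parcs G" if u: "u \<in> pverts G - S" for u
  proof (cases "u \<in> g ` S")
    case True
    then obtain x where "x \<in> S" "u = g x" by blast
    then show ?thesis using fg[of x] g(2)[of x] by simp
  next
    case False
    have "\<exists>x. x \<in> S \<and> (x, u) \<in> parcs G" using assms(3)[OF u] by blast
    then have "(SOME x. x \<in> S \<and> (x, u) \<in> parcs G) \<in> S \<and>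
        ((SOME x. x \<in> S \<and> (x, u) \<in> parcs G), u) \<in> parcs G" by (rule someI_ex)
    then show ?thesis using False by (simp add: f_def)
  qed
  have sg: "star_graph G S (pverts G - S) f"
    using assms(1,2) f by (simp add: star_graph_def)
  have "g x \<in> pverts G - S" if "x \<in> S" for x
    using g(2)[OF that] pair_graph_verts[OF assms(1)] star_graph.S_indep[OF sg that] by blast
  then have "S \<subseteq> f ` (pverts G - S)" using fg by (metis image_eqI subsetI)
  moreover have "f ` (pverts G - S) \<subseteq> S" using f by blast
  ultimately show ?thesis using that[OF sg] by blast
qed

lemma ex_star_graph:
  assumes "pair_graph G" "independent_set G S" "\<And>u. u \<in> pverts G - S \<Longrightarrow> \<exists>x\<in>S. (x, u) \<in> parcs G"
  obtains f where "star_graph G S (pverts G - S) f"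
proof -
  have "\<forall>u\<in>pverts G - S. \<exists>x. x \<in> S \<and> (x, u) \<in> parcs G" using assms(3) by blast
  from bchoice[OF this] obtain f where "\<forall>u\<in>pverts G - S. f u \<in> S \<and> (f u, u) \<in> parcs G" ..
  then have "star_graph G S (pverts G - S) f" using assms(1,2) by (simp add: star_graph_def)
  then show ?thesis using that by blast
qed

lemma connected_neighbour:
  assumes "pair_graph G" "Digraph_Component.connected (with_proj G)" "x \<in> pverts G" "card (pverts G) \<ge> 2"
  shows "parcs G `` {x} \<noteq> {}"
proof -
  have "{x} \<noteq> pverts G"
  proof
    assume "{x} = pverts G"
    then have "card (pverts G) = card {x}" by simp
    then show False using assms(4) by simp
  qed
  then obtain a b where "(a, b) \<in> parcs G" "a \<in> {x}"
    using connected_cut[OF assms(1,2), of "{x}"] assms(3) by blast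
  then show ?thesis by blast
qed

section \<open>Graphs with small independence number\<close>

text \<open>If no centre dominates the leaves, there is an edge among them: otherwise the leaves would be an
independent set, thus exactly one private leaf for each of the two centres, and the graph would be
disconnected.\<close>

lemma antimagic_independence_le_2:
  fixes G :: "'a pair_pre_digraph"
  assumes G: "pair_graph G" "Digraph_Component.connected (with_proj G)" and "independence_number G \<le> 2"
  shows "\<exists>D \<tau>. antimagic_orientation G D \<tau>"
proof -
  obtain S where S: "independent_set G S" "card S = independence_number G"
    and max: "\<And>X. independent_set G X \<Longrightarrow> card X \<le> independence_number G"
    using ex_maximum_independent_set[OF G(1)] by blast
  have dom: "\<exists>x\<in>S. (x, u) \<in> parcs G" if "u \<in> pverts G - S" for u
    using maximum_independent_dominating[OF G(1) S(1) _ that] max S(2) by simp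
  obtain v where v: "v \<in> pverts G"
    using G(2) by (auto simp: Digraph_Component.connected_def strongly_connected_def)
  have "independent_set G {v}" using v by (simp add: independent_set_def)
  from max[OF this] have "card S \<ge> 1" using S(2) by simp
  then consider "card S = 1" | "card S = 2" using assms(3) S(2) by linarith
  then show ?thesis
  proof cases
    case 1
    then obtain x where x: "S = {x}" by (rule card_1_singletonE)
    obtain f where "star_graph G S (pverts G - S) f" using ex_star_graph[OF G(1) S(1) dom] by blast
    then show ?thesis using x by (rule star_graph.antimagic_one_centre)
  next
    case 2
    then obtain x y where xy: "S = {x, y}" "x \<noteq> y" by (auto simp: card_2_iff)
    have Sub: "S \<subseteq> pverts G" using S(1) by (simp add: independent_set_def)
    then have c2: "card (pverts G) \<ge> 2" using card_mono[OF pair_graph_finite[OF G(1)] Sub] 2 by simp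
    have nbr: "parcs G `` {z} \<noteq> {}" if "z \<in> S" for z
      using connected_neighbour[OF G _ c2] Sub that by blast
    define U where "U = pverts G - S"
    obtain f where f: "star_graph G S U f" unfolding U_def using ex_star_graph[OF G(1) S(1) dom] by blast
    have indep: "(a, b) \<notin> parcs G" if "a \<in> S" "b \<in> S" for a b
      using star_graph.S_indep[OF f that] .
    have "U \<noteq> {}"
    proof -
      obtain w where "(x, w) \<in> parcs G" using nbr[of x] xy by blast
      then have "w \<in> U" using indep[of x w] pair_graph_verts[OF G(1)] xy(1) unfolding U_def by blast
      then show ?thesis by blast
    qed
    have all: "\<exists>D \<tau>. antimagic_orientation G D \<tau>"
      if b: "\<And>u. u \<in> U \<Longrightarrow> (b, u) \<in> parcs G" "S = {a, b}" "a \<noteq> b" for a b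
    proof -
      have sg: "star_graph G S U (\<lambda>_. b)"
        using G(1) S(1) b(1,2) by (simp add: star_graph_def U_def)
      show ?thesis
        by (rule star_graph.antimagic_dominating_centre[OF sg b(2,3) _ \<open>U \<noteq> {}\<close>]) simp
    qed
    show ?thesis
    proof (cases "(\<forall>u\<in>U. (y, u) \<in> parcs G) \<or> (\<forall>u\<in>U. (x, u) \<in> parcs G)")
      case True
      then show ?thesis using all[of y x] all[of x y] xy by blast
    next
      case False
      then obtain u1 u2 where u: "u1 \<in> U" "(y, u1) \<notin> parcs G" "u2 \<in> U" "(x, u2) \<notin> parcs G" by blast
      have xu1: "(x, u1) \<in> parcs G" using dom[of u1] u(1,2) xy(1) by (auto simp: U_def)
      then have ne: "u1 \<noteq> u2" using u(4) by blast
      interpret star_graph G S U f by (rule f)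
      have "L \<noteq> {}"
      proof
        assume L0: "L = {}"
        then have noUU: "(a, b) \<notin> parcs G" if "a \<in> U" "b \<in> U" for a b
          using that by (auto simp: L_def)
        then have "independent_set G U" by (auto simp: independent_set_def pairwise_def U_def)
        then have "card U \<le> 2" using max assms(3) by fastforce
        then have "card U \<le> card {u1, u2}" using ne by simp
        moreover have "{u1, u2} \<subseteq> U" using u by blast
        ultimately have U2: "{u1, u2} = U" using card_seteq[OF finU] by blast
        have "{x, u1} \<subseteq> pverts G" using xy(1) Sub u(1) by (auto simp: U_def)
        moreover have "y \<notin> {x, u1}" "y \<in> pverts G" using xy Sub u(1) by (auto simp: U_def)
        then have "{x, u1} \<noteq> pverts G" by blast
        ultimately obtain a b where ab: "(a, b) \<in> parcs G" "a \<in> {x, u1}" "b \<notin> {x, u1}"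
          using connected_cut[OF G, of "{x, u1}"] by blast
        have "b \<in> S \<union> U" using pair_graph_verts[OF G(1) ab(1)] by (auto simp: U_def)
        then have b: "b = y \<or> b = u2" using ab(3) xy(1) U2 by blast
        show False
        proof (cases "a = x")
          case True
          then show False using b ab(1) indep[of x y] u(4) xy(1) by blast
        next
          case False
          then have "a = u1" using ab(2) by blast
          then show False using b ab(1) pair_graph_sym[OF G(1), of u1 y] u noUU[of u1 u2] by blast
        qed
      qed
      have fin: "finite (parcs G `` {z})" for z using fin(2) by (rule finite_Image)
      have "card (parcs G `` {z}) \<ge> 1" if "z \<in> S" for z
        using nbr[OF that] fin[of z] by (simp add: Suc_le_eq card_gt_0_iff)
      then consider "card (parcs G `` {x}) = 1" | "card (parcs G `` {y}) = 1"
        | "card (parcs G `` {x}) \<ge> 2" "card (parcs G `` {y}) \<ge> 2"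
        using xy(1) by (metis One_nat_def Suc_1 insertCI le_antisym not_less_eq_eq)
      then show ?thesis
      proof cases
        case 1
        show ?thesis using xy 1 nbr[of y] \<open>L \<noteq> {}\<close> by (intro antimagic_two_centres_pendant) auto
      next
        case 2
        have "S = {y, x}" using xy(1) by blast
        then show ?thesis
          using xy(2) 2 nbr[of x] \<open>L \<noteq> {}\<close> by (intro antimagic_two_centres_pendant[of y x]) auto
      next
        case 3
        show ?thesis using xy(1) 3 by (intro antimagic_two_centres_parity[OF xy _ \<open>L \<noteq> {}\<close>]) blast
      qed
    qed
  qed
qed

lemma (in star_graph) independent_if_L_free:
  assumes "X \<subseteq> U" "pairwise (\<lambda>u v. (u, v) \<notin> L) X"
  shows "independent_set G X"
  using assms unfolding independent_set_def pairwise_def L_def U_iff by (auto simp: subset_iff U_iff)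

text \<open>Representatives of the three neighbourhoods exist unless two centres are pendant at the same vertex,
because some centre has at least three neighbours.\<close>

lemma antimagic_independence_3:
  fixes G :: "'a pair_pre_digraph"
  assumes G: "pair_graph G" "Digraph_Component.connected (with_proj G)"
    and alpha: "independence_number G = 3" and n: "card (pverts G) \<ge> 13"
  shows "\<exists>D \<tau>. antimagic_orientation G D \<tau>"
proof -
  obtain S where S: "independent_set G S" "card S = 3"
    and max: "\<And>X. independent_set G X \<Longrightarrow> card X \<le> 3"
    using ex_maximum_independent_set[OF G(1)] alpha by metis
  have dom: "\<exists>x\<in>S. (x, u) \<in> parcs G" if "u \<in> pverts G - S" for u
    using maximum_independent_dominating[OF G(1) S(1) _ that] max S(2) by simp
  have Sub: "S \<subseteq> pverts G" using S(1) by (simp add: independent_set_def)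
  have finS: "finite S" using Sub pair_graph_finite[OF G(1)] by (rule finite_subset)
  define U where "U = pverts G - S"
  have cU: "card U \<ge> 10" unfolding U_def using n S(2) card_Diff_subset[OF finS Sub] by simp
  obtain f0 where f0: "star_graph G S U f0" unfolding U_def using ex_star_graph[OF G(1) S(1) dom] by blast
  have nbr: "parcs G `` {z} \<noteq> {}" if "z \<in> S" for z
    using connected_neighbour[OF G] n Sub that by auto
  show ?thesis
  proof (cases "\<exists>x\<in>S. \<exists>y\<in>S. x \<noteq> y \<and> (\<exists>u. parcs G `` {x} = {u} \<and> parcs G `` {y} = {u})")
    case True
    then obtain x y u where xy: "x \<in> S" "y \<in> S" "x \<noteq> y" "parcs G `` {x} = {u}" "parcs G `` {y} = {u}"
      by blast
    have "card (S - {x, y}) = 1" using S(2) xy(1-3) by (subst card_Diff_subset) auto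
    then obtain z where "S - {x, y} = {z}" by (rule card_1_singletonE)
    then have "S = {x, y, z}" using xy(1,2) by blast
    then show ?thesis using star_graph.antimagic_twin_pendants[OF f0 _ S(2) xy(4,5) cU] by blast
  next
    case False
    have finN: "finite (parcs G `` {z})" for z
      using star_graph.fin(2)[OF f0] by (rule finite_Image)
    have "\<exists>z\<in>S. card (parcs G `` {z}) \<ge> 3"
    proof (rule ccontr)
      assume *: "\<not> ?thesis"
      have "U \<subseteq> (\<Union>z\<in>S. parcs G `` {z})" using dom by (auto simp: U_def)
      then have "card U \<le> card (\<Union>z\<in>S. parcs G `` {z})"
        using finS finN by (intro card_mono) auto
      also have "\<dots> \<le> (\<Sum>z\<in>S. card (parcs G `` {z}))" by (rule card_UN_le[OF finS])
      also have "\<dots> \<le> (\<Sum>z\<in>S. 3)" using * by (intro sum_mono) (auto simp: not_le)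
      also have "\<dots> = 9" using S(2) by simp
      finally show False using cU by simp
    qed
    then obtain z where z: "z \<in> S" "card (parcs G `` {z}) \<ge> 3" by blast
    have "card (S - {z}) = 2" using S(2) z(1) by simp
    then obtain x y where "S - {z} = {x, y}" "x \<noteq> y" by (auto simp: card_2_iff)
    then have xyz: "S = {x, y, z}" "x \<noteq> y" "x \<noteq> z" "y \<noteq> z" using z(1) by auto
    obtain u1 u2 where u12: "(x, u1) \<in> parcs G" "(y, u2) \<in> parcs G" "u1 \<noteq> u2"
    proof -
      obtain a where a: "(x, a) \<in> parcs G" using nbr[of x] xyz(1) by blast
      obtain b where b: "(y, b) \<in> parcs G" using nbr[of y] xyz(1) by blast
      have "\<not> (parcs G `` {x} = {a} \<and> parcs G `` {y} = {a})" using False xyz by blast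
      then have "a \<noteq> b \<or> (\<exists>c. c \<noteq> a \<and> ((x, c) \<in> parcs G \<or> (y, c) \<in> parcs G))" using a b by blast
      then show ?thesis using that a b by metis
    qed
    have "\<not> parcs G `` {z} \<subseteq> {u1, u2}"
    proof
      assume "parcs G `` {z} \<subseteq> {u1, u2}"
      then have "card (parcs G `` {z}) \<le> card {u1, u2}" by (intro card_mono) auto
      then show False using z(2) u12(3) by simp
    qed
    then obtain u3 where u3: "(z, u3) \<in> parcs G" "u3 \<noteq> u1" "u3 \<noteq> u2" by blast
    define g where "g v = (if v = x then u1 else if v = y then u2 else u3)" for v
    have g: "inj_on g S" "\<And>v. v \<in> S \<Longrightarrow> (v, g v) \<in> parcs G"
      using u12 u3 xyz by (auto simp: g_def inj_on_def)
    obtain f where sg: "star_graph G S U f" "f ` U = S"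
      unfolding U_def using star_graph_of_representatives[OF G(1) S(1) dom g] by blast
    interpret star_graph G S U f by (rule sg(1))
    have LU: "L \<subseteq> U \<times> U" by (auto simp: L_def)
    have ind: "card X \<le> 3" if "X \<subseteq> U" "pairwise (\<lambda>u v. (u, v) \<notin> L) X" for X
      using max[OF independent_if_L_free[OF that]] .
    obtain C D where CD: "dicycles L [C, D]" "\<And>v. lsum 0 C v + lsum 0 D v \<ge> - 1"
      using two_disjoint_cycles[OF finU LU symL irreflL cU ind] by blast
    have "length C \<ge> 1" "length D \<ge> 1"
      using CD(1) dicycle_nonempty[of L C] dicycle_nonempty[of L D] by (auto simp: dicycles_def Suc_le_eq)
    then have "separating (map length [C, D]) S"
      using separating_two[OF S(2)] by simp
    moreover have "1 \<le> card (parcs G `` {v})" if "v \<in> S" for v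
      using nbr[OF that] finN[of v] by (simp add: Suc_le_eq card_gt_0_iff)
    ultimately show ?thesis
      using CD(2) by (intro antimagic_by_cycles[OF sg(2) CD(1), where K = 1]) simp_all
  qed
qed

lemma min_degree_le:
  assumes "pair_graph G" "v \<in> pverts G"
  shows "min_degree G \<le> card (parcs G `` {v})"
proof -
  have "out_arcs (with_proj G) v = Pair v ` (parcs G `` {v})"
    by (auto simp: out_arcs_def)
  then have "out_degree (with_proj G) v = card (parcs G `` {v})"
    unfolding out_degree_def by (simp add: card_image inj_on_def)
  moreover have "min_degree G \<le> out_degree (with_proj G) v"
    unfolding min_degree_def using assms pair_graph_finite[OF assms(1)] by (intro Min_le) auto
  ultimately show ?thesis by simp
qed

text \<open>A leaf has at most four of its eleven neighbours in S, so the edges among the leaves have minimum degree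
at least 7 = 2 \<cdot> 3 + 1 and contain 1 + 2 + 3 edge-disjoint cycles, as many as there are pairs of
centres.\<close>

lemma antimagic_independence_4:
  fixes G :: "'a pair_pre_digraph"
  assumes G: "pair_graph G" and alpha: "independence_number G = 4" and deg: "min_degree G \<ge> 11"
  shows "\<exists>D \<tau>. antimagic_orientation G D \<tau>"
proof -
  obtain S where S: "independent_set G S" "card S = 4"
    and max: "\<And>X. independent_set G X \<Longrightarrow> card X \<le> 4"
    using ex_maximum_independent_set[OF G(1)] alpha by metis
  have dom: "\<exists>x\<in>S. (x, u) \<in> parcs G" if "u \<in> pverts G - S" for u
    using maximum_independent_dominating[OF G(1) S(1) _ that] max S(2) by simp
  have Sub: "S \<subseteq> pverts G" using S(1) by (simp add: independent_set_def)
  have finS: "finite S" using Sub pair_graph_finite[OF G(1)] by (rule finite_subset)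
  have d: "card (parcs G `` {v}) \<ge> 11" if "v \<in> pverts G" for v
    using min_degree_le[OF G that] deg by simp
  have P: "finite (parcs G `` {x}) \<and> card S \<le> card (parcs G `` {x})" if "x \<in> S" for x
  proof -
    have "card (parcs G `` {x}) \<ge> 11" using d Sub that by blast
    moreover from this have "finite (parcs G `` {x})" by (intro card_ge_0_finite) simp
    ultimately show ?thesis using S(2) by simp
  qed
  have "\<exists>g. inj_on g S \<and> (\<forall>x\<in>S. g x \<in> parcs G `` {x})"
    by (rule system_of_representatives[OF finS]) (rule P)
  then obtain g where g: "inj_on g S" "\<forall>x\<in>S. g x \<in> parcs G `` {x}" by blast
  define U where "U = pverts G - S"
  obtain f where sg: "star_graph G S U f" "f ` U = S"
    unfolding U_def using star_graph_of_representatives[OF G(1) S(1) dom g(1)] g(2) by blast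
  interpret star_graph G S U f by (rule sg(1))
  have LU: "L \<subseteq> U \<times> U" by (auto simp: L_def)
  have "S \<noteq> {}" using S(2) by auto
  then have Une: "U \<noteq> {}" using sg(2) by blast
  have degL: "card (L `` {w}) \<ge> 2 * 3 + 1" if "w \<in> U" for w
  proof -
    have w: "w \<in> pverts G" using that by (simp add: U_def)
    have "parcs G `` {w} \<subseteq> L `` {w} \<union> S" using arcs_verts that by (auto simp: L_def U_iff)
    then have "card (parcs G `` {w}) \<le> card (L `` {w} \<union> S)"
      using finL finS by (intro card_mono) auto
    also have "\<dots> \<le> card (L `` {w}) + card S" by (rule card_Un_le)
    finally show ?thesis using d[OF w] S(2) by simp
  qed
  obtain Cs where Cs: "length Cs = \<Sum>{..3::nat}" "dicycles L Cs"
    using edge_disjoint_cycles[OF finU Une LU symL irreflL degL] by blast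
  have six: "\<Sum>{..3::nat} = 6" "\<Sum>{..<4::nat} = 6" by (simp_all add: numeral_eq_Suc)
  have dic: "dicycle L C" if "C \<in> set Cs" for C using Cs(2) that by (simp add: dicycles_def)
  have "(\<Sum>C\<leftarrow>Ds. lsum 0 C v) \<ge> - int (length Ds)" if "set Ds \<subseteq> set Cs" for Ds v
    using that
  proof (induction Ds)
    case (Cons C Ds)
    have "lsum 0 C v \<ge> - 1" using dic[of C] Cons.prems by (intro dicycle_lsum_ge) auto
    then show ?case using Cons by simp
  qed simp
  from this[of Cs] have K: "(\<Sum>C\<leftarrow>Cs. lsum 0 C v) \<ge> - int 6" for v using Cs(1) six by simp
  have "q \<ge> 1" if "q \<in> set (map length Cs)" for q
    using that dic dicycle_nonempty by (auto simp: Suc_le_eq)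
  then have "separating (map length Cs) S"
    using Cs(1) six S(2) by (intro separating_many) auto
  moreover have "6 \<le> card (parcs G `` {x})" if "x \<in> S" for x
  proof -
    have "card (parcs G `` {x}) \<ge> 11" using d Sub that by blast
    then show ?thesis by simp
  qed
  ultimately show ?thesis
    using K by (intro antimagic_by_cycles[OF sg(2) Cs(2), where K = 6])
qed

theorem theorem1p6:
  fixes G :: "'a pair_pre_digraph"
  assumes "pair_graph G" and "Digraph_Component.connected (with_proj G)"
  shows "(independence_number G \<le> 2 \<longrightarrow> (\<exists>D \<tau>. antimagic_orientation G D \<tau>)) \<and>
         (independence_number G = 3 \<and> card (pverts G) \<ge> 13 \<longrightarrow>
            (\<exists>D \<tau>. antimagic_orientation G D \<tau>)) \<and>
         (independence_number G = 4 \<and> min_degree G \<ge> 11 \<longrightarrow>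
            (\<exists>D \<tau>. antimagic_orientation G D \<tau>))"
  using antimagic_independence_le_2[OF assms] antimagic_independence_3[OF assms]
    antimagic_independence_4[OF assms(1)] by blast

end
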